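(* Let $d\ge 0$ be an integer, let $F\in Q_d$ be a homogeneous real bivariate form of degree $d$, and fix an integer $i$ with $0\leq i\leq \lfloor d/2\rfloor$. If the Toeplitz matrix $\phi^i_d(F)$ is totally nonnegative, then $A_F$ satisfies the mixed HRR$_i$ on $U=\{ax+by \mid (a,b)\in\mathbb{R}^2_{>0}\}$.
   Context: $Q=\mathbb{R}[X,Y]$ with its standard grading, $Q_d$ is the space of forms of degree $d$. $R=\mathbb{R}[x,y]$ acts on $Q$ by differentiation: $x\circ F=\partial F/\partial X$, $y\circ F=\partial F/\partial Y$. For $F\in Q_d$, $\operatorname{Ann}(F)=\{\alpha\in R\mid \alpha\circ F=0\}$ and $A_F=R/\operatorname{Ann}(F)$, a graded Artinian Gorenstein algebra, oriented by the linear map $\int_F:(A_F)_d\to\mathbb{R}$, $\int_F\alpha=\alpha\circ F$. Linear forms in $R_1$ are also regarded as elements of $A_F$. Write $F=\sum_{k=0}^d\binom{d}{k}c_kX^kY^{d-k}$. The $i$-th Toeplitz matrix of $F$ is the $(i+1)\times(d-i+1)$ matrix $\phi^i_d(F)=(c_{i+q-p})_{0\leq p\leq i,\ 0\leq q\leq d-i}$. A matrix is totally nonnegative if all its minors (of all sizes) are $\geq 0$. Mixed HRR$_i$ on $U$: $A_F$ satisfies the mixed Hodge–Riemann relations up to degree $i$ on $U$ if for every sequence $(\ell_0,\ell_1,\ldots,\ell_d)\in U^{d+1}$, every $j$ with $0\leq j\leq i$, and every nonzero $\alpha\in (A_F)_j$ that is primitive, i.e. $\ell_0\ell_1\cdots\ell_{d-2j}\,\alpha=0$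 in $A_F$, one has $(-1)^j\int_F \ell_1\cdots\ell_{d-2j}\,\alpha^2>0$ (the empty product being $1$). *)

theory Defs
  imports
    "HOL-Algebra.QuotRing"
    "HOL-Algebra.Algebraic_Closure_Type"
    "Jordan_Normal_Form.Determinant"
    "Jordan_Normal_Form.DL_Submatrix"
    "HOL-Computational_Algebra.Polynomial"
begin

text \<open>Both polynomial rings \<open>Q = \<real>[X,Y]\<close> and \<open>R = \<real>[x,y]\<close> are encoded as \<open>\<real>[X][Y]\<close>,
  that is, the second variable is the outer one.\<close>

type_synonym bipoly = "real poly poly"

definition bicoeff :: "bipoly \<Rightarrow> nat \<Rightarrow> nat \<Rightarrow> real" where
  "bicoeff P a b = Polynomial.coeff (Polynomial.coeff P b) a"  \<comment> \<open>the coefficient of \<open>X\<^sup>a Y\<^sup>b\<close>\<close>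

definition forms :: "nat \<Rightarrow> bipoly set" where
  "forms d = {P. \<forall>a b. bicoeff P a b \<noteq> 0 \<longrightarrow> a + b = d}"

definition lin :: "real \<Rightarrow> real \<Rightarrow> bipoly" where
  "lin a b = [:[:0, a:], [:b:]:]"  \<comment> \<open>\<open>a x + b y\<close>\<close>

definition dX :: "bipoly \<Rightarrow> bipoly" where
  "dX = map_poly pderiv"

definition dY :: "bipoly \<Rightarrow> bipoly" where
  "dY = pderiv"

definition act :: "bipoly \<Rightarrow> bipoly \<Rightarrow> bipoly" (infixr \<open>\<bullet>\<^sub>d\<close> 75) where
  "\<alpha> \<bullet>\<^sub>d F = (\<Sum>b\<le>Polynomial.degree \<alpha>. \<Sum>a\<le>Polynomial.degree (Polynomial.coeff \<alpha> b).
      smult [:bicoeff \<alpha> a b:] ((dX ^^ a) ((dY ^^ b) F)))"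

abbreviation R_ring :: "bipoly ring" where
  "R_ring \<equiv> ring_of_type_algebra"

definition Ann :: "bipoly \<Rightarrow> bipoly set" where
  "Ann F = {\<alpha>. \<alpha> \<bullet>\<^sub>d F = 0}"

definition A_alg :: "bipoly \<Rightarrow> bipoly set ring" where
  "A_alg F = R_ring Quot Ann F"

definition cls :: "bipoly \<Rightarrow> bipoly \<Rightarrow> bipoly set" where
  "cls F \<alpha> = Ann F +>\<^bsub>R_ring\<^esub> \<alpha>"

definition A_deg :: "bipoly \<Rightarrow> nat \<Rightarrow> bipoly set set" where
  "A_deg F j = cls F ` forms j"

text \<open>For \<open>F\<close> of degree \<open>d\<close> and \<open>u\<close> in \<open>A_deg F d\<close>, the polynomial \<open>\<alpha> \<bullet>\<^sub>d F\<close> is a constant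
  that is the same for all representatives \<open>\<alpha>\<close> of \<open>u\<close>.\<close>

definition integral_F :: "bipoly \<Rightarrow> bipoly set \<Rightarrow> real" where
  "integral_F F u = (THE c. \<forall>\<alpha>\<in>u. \<alpha> \<bullet>\<^sub>d F = [:[:c:]:])"

text \<open>The degree \<open>d\<close> is a parameter because the zero form has every degree.\<close>

definition mixed_HRR :: "nat \<Rightarrow> bipoly \<Rightarrow> nat \<Rightarrow> bipoly set \<Rightarrow> bool" where
  "mixed_HRR d F i U \<longleftrightarrow>
    (\<forall>l :: nat \<Rightarrow> bipoly. (\<forall>k\<le>d. l k \<in> U) \<longrightarrow>
      (\<forall>j\<le>i. \<forall>\<alpha> \<in> A_deg F j.
        \<alpha> \<noteq> \<zero>\<^bsub>A_alg F\<^esub> \<longrightarrow>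
        (\<Otimes>\<^bsub>A_alg F\<^esub>k\<in>{0..d - 2 * j}. cls F (l k)) \<otimes>\<^bsub>A_alg F\<^esub> \<alpha> = \<zero>\<^bsub>A_alg F\<^esub> \<longrightarrow>
        (-1) ^ j * integral_F F
          ((\<Otimes>\<^bsub>A_alg F\<^esub>k\<in>{1..d - 2 * j}. cls F (l k)) \<otimes>\<^bsub>A_alg F\<^esub> (\<alpha> [^]\<^bsub>A_alg F\<^esub> (2::nat))) > 0))"

text \<open>\<open>divided_coeff d F k\<close> is the \<open>c\<^sub>k\<close> in \<open>F = (\<Sum>k\<le>d. (d choose k) c\<^sub>k X\<^sup>k Y\<^bsup>d-k\<^esup>)\<close>.\<close>

definition divided_coeff :: "nat \<Rightarrow> bipoly \<Rightarrow> nat \<Rightarrow> real" where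
  "divided_coeff d F k = bicoeff F k (d - k) / real (d choose k)"

definition toeplitz :: "nat \<Rightarrow> nat \<Rightarrow> bipoly \<Rightarrow> real mat" where
  "toeplitz d i F = mat (i + 1) (d - i + 1) (\<lambda>(p, q). divided_coeff d F (i + q - p))"

definition totally_nonneg :: "real mat \<Rightarrow> bool" where
  "totally_nonneg M \<longleftrightarrow>
    (\<forall>I J. I \<subseteq> {..<dim_row M} \<and> J \<subseteq> {..<dim_col M} \<and> card I = card J \<longrightarrow>
      det (submatrix M I J) \<ge> 0)"

end

theory Submission
  imports Defs
begin

text \<open>
  Setting \<open>y = 1\<close> turns a form \<open>\<alpha>\<close> of degree \<open>m\<close> into a polynomial of degree at most \<open>m\<close>, and
  \<open>\<alpha> \<circ> F\<close> has, up to positive factors, the coefficients \<open>E(\<alpha> t\<^sup>u)\<close> for the linear functional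
  \<open>E(t\<^sup>k) = c\<^sub>k\<close>. A linear form \<open>a x + b y\<close> replaces \<open>c\<^sub>k\<close> by \<open>b c\<^sub>k + a c\<^bsub>k+1\<^esub>\<close>. On a Toeplitz matrix this
  adds neighbouring rows (and loses one row) or adds neighbouring columns (and loses one column);
  by multilinearity of the determinant, both operations preserve total nonnegativity and, for
  \<open>a, b > 0\<close>, also the existence of a nonzero minor of any size that still fits. Hence if
  \<open>\<phi>\<^sup>i(F)\<close> has a nonzero minor of size \<open>k\<close>, any \<open>d + 2 - 2k\<close> positive linear forms turn it into a \<open>k \<times> k\<close>
  matrix of positive determinant.

  Let \<open>\<alpha>\<close> be primitive of degree \<open>j\<close>. If there are nonzero minors of sizes \<open>j + 1\<close> and \<open>j\<close>, put
  \<open>G = \<ell>\<^sub>1 \<cdots> \<ell>\<^bsub>d-2j\<^esub> \<circ> F\<close>. In the basis \<open>\<alpha>, \<ell>\<^sub>0, \<ell>\<^sub>0 t, \<dots>, \<ell>\<^sub>0 t\<^bsup>j-1\<^esup>\<close> the form \<open>(\<beta>, \<gamma>) \<mapsto> \<beta> \<gamma> \<circ> G\<close> is block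
  diagonal, and comparing determinants gives the sign of \<open>\<alpha>\<^sup>2 \<circ> G\<close>. Otherwise the rank \<open>\<rho>\<close> of
  \<open>\<phi>\<^sup>i(F)\<close> is at most \<open>j\<close>; then every form of degree \<open>m \<ge> i\<close> is, modulo \<open>Ann F\<close>, a multiple of a
  prescribed product of \<open>m + 1 - \<rho>\<close> positive linear forms. By duality, multiplication by
  \<open>\<ell>\<^sub>0 \<cdots> \<ell>\<^bsub>d-2j\<^esub>\<close> is injective on degree \<open>j\<close>, so there is no nonzero primitive \<open>\<alpha>\<close>.
\<close>

section \<open>Minors of totally nonnegative matrices\<close>

text \<open>Matrices are kept as functions of indices, so that selecting, permuting or bordering
  rows and columns is a mere change of arguments. Only values below \<open>k\<close> count.\<close>

definition detf :: "nat \<Rightarrow> (nat \<Rightarrow> nat \<Rightarrow> real) \<Rightarrow> real" where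
  "detf k R = det (mat k k (\<lambda>(p, q). R p q))"

lemma detf_cong:
  assumes "\<And>p q. p < k \<Longrightarrow> q < k \<Longrightarrow> R p q = S p q"
  shows "detf k R = detf k S"
  unfolding detf_def using assms by (intro arg_cong[of _ _ det] eq_matI) auto

text \<open>The cofactors along row \<open>s\<close> do not involve that row, so the Laplace
  expansion is linear in it.\<close>

lemma detf_row_linear:
  assumes "s < k"
  shows "detf k (\<lambda>p q. if p = s then a * x q + b * y q else R p q) =
    a * detf k (\<lambda>p q. if p = s then x q else R p q) + b * detf k (\<lambda>p q. if p = s then y q else R p q)"
proof -
  define c where "c q = cofactor (mat k k (\<lambda>(p, q). R p q)) s q" for q
  have *: "detf k (\<lambda>p q. if p = s then z q else R p q) = (\<Sum>q<k. z q * c q)" for z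
  proof -
    let ?M = "mat k k (\<lambda>(p, q). if p = s then z q else R p q)"
    have "mat_delete ?M s q = mat_delete (mat k k (\<lambda>(p, q). R p q)) s q" if "q < k" for q
      using that assms by (auto simp: mat_delete_def intro!: eq_matI)
    then have "cofactor ?M s q = c q" if "q < k" for q
      using that by (simp add: c_def cofactor_def)
    then show ?thesis
      unfolding detf_def using assms by (subst laplace_expansion_row[of ?M k s]) auto
  qed
  show ?thesis
    unfolding * by (simp add: sum_distrib_left sum.distrib[symmetric] algebra_simps)
qed

lemma detf_identical_rows:
  assumes "s < k" "t < k" "s \<noteq> t" "\<And>q. q < k \<Longrightarrow> R s q = R t q"
  shows "detf k R = 0"
  unfolding detf_def
  by (rule det_identical_rows[of _ k s t]) (use assms in \<open>auto intro!: eq_vecI\<close>)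

lemma detf_transpose: "detf k (\<lambda>p q. R q p) = detf k R"
proof -
  have "mat k k (\<lambda>(p, q). R q p) = transpose_mat (mat k k (\<lambda>(p, q). R p q))"
    by (intro eq_matI) auto
  then show ?thesis
    unfolding detf_def by (simp add: det_transpose[of _ k])
qed

lemma detf_mult: "detf k (\<lambda>p q. (\<Sum>s<k. U p s * V s q)) = detf k U * detf k V"
proof -
  have "mat k k (\<lambda>(p, q). (\<Sum>s<k. U p s * V s q)) =
      mat k k (\<lambda>(p, q). U p q) * mat k k (\<lambda>(p, q). V p q)"
    by (intro eq_matI) (auto simp: scalar_prod_def intro!: sum.cong)
  then show ?thesis
    unfolding detf_def by (simp add: det_mult[of _ k])
qed

lemma detf_eq_0_iff:
  "detf k R = 0 \<longleftrightarrow> (\<exists>v. (\<exists>q<k. v q \<noteq> 0) \<and> (\<forall>p<k. (\<Sum>q<k. R p q * v q) = 0))"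
proof -
  let ?M = "mat k k (\<lambda>(p, q). R p q)"
  have "detf k R = 0 \<longleftrightarrow> (\<exists>v. v \<in> carrier_vec k \<and> v \<noteq> 0\<^sub>v k \<and> ?M *\<^sub>v v = 0\<^sub>v k)"
    unfolding detf_def by (rule det_0_iff_vec_prod_zero) simp
  also have "\<dots> \<longleftrightarrow> (\<exists>v. (\<exists>q<k. v q \<noteq> 0) \<and> (\<forall>p<k. (\<Sum>q<k. R p q * v q) = 0))"
  proof safe
    fix v :: "real vec" assume v: "v \<in> carrier_vec k" "v \<noteq> 0\<^sub>v k" "?M *\<^sub>v v = 0\<^sub>v k"
    have "(\<Sum>q<k. R p q * vec_index v q) = 0" if "p < k" for p
      using arg_cong[OF v(3), of "\<lambda>w. vec_index w p"] that v(1)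
      by (auto simp: scalar_prod_def lessThan_atLeast0)
    moreover have "\<exists>q<k. vec_index v q \<noteq> 0"
      using v(1,2) by (auto intro!: eq_vecI)
    ultimately show "\<exists>v. (\<exists>q<k. v q \<noteq> 0) \<and> (\<forall>p<k. (\<Sum>q<k. R p q * v q) = 0)"
      by (intro exI[of _ "\<lambda>q. vec_index v q"]) auto
  next
    fix v :: "nat \<Rightarrow> real" and q
    assume v: "\<forall>p<k. (\<Sum>q<k. R p q * v q) = 0" "q < k" "v q \<noteq> 0"
    have "vec k v \<noteq> 0\<^sub>v k"
      using v(2,3) by (metis index_vec index_zero_vec(1))
    moreover have "?M *\<^sub>v vec k v = 0\<^sub>v k"
      using v(1) by (intro eq_vecI) (auto simp: scalar_prod_def lessThan_atLeast0)
    ultimately show "\<exists>v. v \<in> carrier_vec k \<and> v \<noteq> 0\<^sub>v k \<and> ?M *\<^sub>v v = 0\<^sub>v k"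
      by (intro exI[of _ "vec k v"]) auto
  qed
  finally show ?thesis .
qed

text \<open>Both reversals are multiplication by the same permutation matrix, once on each side, and
  the square of its determinant is 1.\<close>

lemma detf_reverse: "detf k (\<lambda>p q. R (k - 1 - p) (k - 1 - q)) = detf k R"
proof -
  define J :: "nat \<Rightarrow> nat \<Rightarrow> real" where "J p q = (if q = k - 1 - p then 1 else 0)" for p q
  have J: "(\<Sum>s<k. J p s * U s) = U (k - 1 - p)" if "p < k" for U p
    using that by (simp add: J_def if_distrib[of "\<lambda>x. x * _"] sum.delta cong: if_cong)
  have J': "(\<Sum>s<k. U s * J s q) = U (k - 1 - q)" if "q < k" for U q
  proof -
    have "(\<Sum>s<k. U s * J s q) = (\<Sum>s<k. if s = k - 1 - q then U s else 0)"
      using that by (intro sum.cong) (auto simp: J_def)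
    then show ?thesis using that by simp
  qed
  have "detf k J * detf k J = detf k (\<lambda>p q. if p = q then 1 else 0)"
    unfolding detf_mult[symmetric] by (rule detf_cong, subst J) (auto simp: J_def)
  also have "\<dots> = det (1\<^sub>m k)"
    unfolding detf_def by (intro arg_cong[of _ _ det] eq_matI) auto
  finally have 1: "detf k J * detf k J = 1" by simp
  have "detf k (\<lambda>p q. R (k - 1 - p) (k - 1 - q)) =
      detf k (\<lambda>p q. (\<Sum>s<k. J p s * (\<Sum>t<k. R s t * J t q)))"
    by (rule detf_cong) (simp add: J J')
  also have "\<dots> = detf k J * (detf k R * detf k J)"
    unfolding detf_mult ..
  finally show ?thesis using 1 by (simp add: mult.left_commute)
qed

section \<open>Minors, and the effect of adding adjacent rows\<close>

definition incr :: "nat \<Rightarrow> nat \<Rightarrow> (nat \<Rightarrow> nat) \<Rightarrow> bool" where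
  "incr k m f \<longleftrightarrow> (\<forall>p<k. f p < m) \<and> (\<forall>p q. p < q \<longrightarrow> q < k \<longrightarrow> f p < f q)"

text \<open>The selections are increasing maps instead of the index sets of
  \<open>totally_nonneg\<close>; \<open>totally_nonneg_imp_tnn\<close> passes from one to the
  other.\<close>

definition tnn :: "nat \<Rightarrow> nat \<Rightarrow> (nat \<Rightarrow> nat \<Rightarrow> real) \<Rightarrow> bool" where
  "tnn m n A \<longleftrightarrow> (\<forall>k f g. incr k m f \<longrightarrow> incr k n g \<longrightarrow> 0 \<le> detf k (\<lambda>p q. A (f p) (g q)))"

definition nonzero_minor :: "nat \<Rightarrow> nat \<Rightarrow> (nat \<Rightarrow> nat \<Rightarrow> real) \<Rightarrow> nat \<Rightarrow> bool" where
  "nonzero_minor m n A k \<longleftrightarrow> (\<exists>f g. incr k m f \<and> incr k n g \<and> detf k (\<lambda>p q. A (f p) (g q)) \<noteq> 0)"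

lemma tnn_transpose: "tnn n m (\<lambda>p q. A q p) \<longleftrightarrow> tnn m n A"
  unfolding tnn_def by (subst detf_transpose[of _ "\<lambda>p q. A (_ p) (_ q)"]) auto

lemma nonzero_minor_transpose: "nonzero_minor n m (\<lambda>p q. A q p) k \<longleftrightarrow> nonzero_minor m n A k"
  unfolding nonzero_minor_def by (subst detf_transpose[of _ "\<lambda>p q. A (_ p) (_ q)"]) auto

text \<open>Expanding the remaining rows one at a time gives a nonnegative combination of
  determinants with rows \<open>h p\<close>, each \<open>f p\<close> or its successor. Such an
  \<open>h\<close> is weakly increasing, so these are minors of \<open>A\<close> or have a repeated
  row.\<close>

lemma minor_of_row_sums:
  assumes tnn: "tnn (Suc m) n A" and ab: "a > 0" "b > 0" and f: "incr k m f" and g: "incr k n g"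
    and "s \<le> k" and "\<forall>t<s. h t = f t \<or> h t = Suc (f t)"
  shows "0 \<le> detf k (\<lambda>p q. if p < s then A (h p) (g q) else a * A (f p) (g q) + b * A (Suc (f p)) (g q))"
    (is "0 \<le> ?D s h")
  using assms(6,7)
proof (induction "k - s" arbitrary: s h)
  case 0
  then have s: "s = k" by simp
  have D: "?D s h = detf k (\<lambda>p q. A (h p) (g q))"
    unfolding s by (rule detf_cong) simp
  have le: "h p \<le> h q" if "p < q" "q < k" for p q
  proof -
    have "f p < f q" using f that by (simp add: incr_def)
    then show ?thesis
      using that 0(3)[rule_format, of p] 0(3)[rule_format, of q] s by auto
  qed
  show ?case
  proof (cases "\<forall>p q. p < q \<longrightarrow> q < k \<longrightarrow> h p < h q")
    case True
    have "h p < Suc m" if "p < k" for p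
      using 0(3)[rule_format, of p] that s f by (auto simp: incr_def less_Suc_eq)
    with True have "incr k (Suc m) h" by (simp add: incr_def)
    then show ?thesis using tnn g unfolding D tnn_def by blast
  next
    case False
    then obtain p q where pq: "p < q" "q < k" "h p = h q"
      using le by (meson le_neq_implies_less)
    then have "?D s h = 0"
      unfolding D by (intro detf_identical_rows[of p k q]) auto
    then show ?thesis by simp
  qed
next
  case (Suc r)
  then have s: "s < k" by simp
  let ?R = "\<lambda>p q. if p < s then A (h p) (g q) else a * A (f p) (g q) + b * A (Suc (f p)) (g q)"
  have "?D s h = detf k (\<lambda>p q. if p = s then a * A (f s) (g q) + b * A (Suc (f s)) (g q) else ?R p q)"
    by (rule detf_cong) auto
  also have "\<dots> = a * detf k (\<lambda>p q. if p = s then A (f s) (g q) else ?R p q)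
      + b * detf k (\<lambda>p q. if p = s then A (Suc (f s)) (g q) else ?R p q)"
    by (rule detf_row_linear[OF s])
  also have "detf k (\<lambda>p q. if p = s then A (f s) (g q) else ?R p q) = ?D (Suc s) (h(s := f s))"
    by (rule detf_cong) auto
  also have "detf k (\<lambda>p q. if p = s then A (Suc (f s)) (g q) else ?R p q) = ?D (Suc s) (h(s := Suc (f s)))"
    by (rule detf_cong) auto
  finally have eq: "?D s h = a * ?D (Suc s) (h(s := f s)) + b * ?D (Suc s) (h(s := Suc (f s)))" .
  have "0 \<le> ?D (Suc s) (h(s := f s))"
    using Suc.prems s Suc.hyps(2) by (intro Suc.hyps(1)) (auto simp: less_Suc_eq)
  moreover have "0 \<le> ?D (Suc s) (h(s := Suc (f s)))"
    using Suc.prems s Suc.hyps(2) by (intro Suc.hyps(1)) (auto simp: less_Suc_eq)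
  ultimately show ?case
    unfolding eq using ab by simp
qed

text \<open>All terms of the same expansion are nonnegative, and the one whose choices are
  \<open>h\<close> is positive.\<close>

lemma minor_of_row_sums_pos:
  assumes tnn: "tnn (Suc m) n A" and ab: "a > 0" "b > 0" and f: "incr k m f" and g: "incr k n g"
    and h: "\<forall>t<k. h t = f t \<or> h t = Suc (f t)" and pos: "0 < detf k (\<lambda>p q. A (h p) (g q))"
    and "s \<le> k"
  shows "0 < detf k (\<lambda>p q. if p < s then A (h p) (g q) else a * A (f p) (g q) + b * A (Suc (f p)) (g q))"
    (is "0 < ?D s h")
  using \<open>s \<le> k\<close>
proof (induction "k - s" arbitrary: s)
  case 0
  then have s: "s = k" by simp
  have D: "?D s h = detf k (\<lambda>p q. A (h p) (g q))"
    unfolding s by (rule detf_cong) simp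
  then show ?case using pos by simp
next
  case (Suc r)
  then have s: "s < k" by simp
  let ?R = "\<lambda>p q. if p < s then A (h p) (g q) else a * A (f p) (g q) + b * A (Suc (f p)) (g q)"
  have "?D s h = detf k (\<lambda>p q. if p = s then a * A (f s) (g q) + b * A (Suc (f s)) (g q) else ?R p q)"
    by (rule detf_cong) auto
  also have "\<dots> = a * detf k (\<lambda>p q. if p = s then A (f s) (g q) else ?R p q)
      + b * detf k (\<lambda>p q. if p = s then A (Suc (f s)) (g q) else ?R p q)"
    by (rule detf_row_linear[OF s])
  also have "detf k (\<lambda>p q. if p = s then A (f s) (g q) else ?R p q) = ?D (Suc s) (h(s := f s))"
    by (rule detf_cong) auto
  also have "detf k (\<lambda>p q. if p = s then A (Suc (f s)) (g q) else ?R p q) = ?D (Suc s) (h(s := Suc (f s)))"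
    by (rule detf_cong) auto
  finally have eq: "?D s h = a * ?D (Suc s) (h(s := f s)) + b * ?D (Suc s) (h(s := Suc (f s)))" .
  have nn: "0 \<le> ?D (Suc s) (h(s := f s))" "0 \<le> ?D (Suc s) (h(s := Suc (f s)))"
    by (rule minor_of_row_sums[OF tnn ab f g]; use h s in \<open>auto simp: less_Suc_eq\<close>)+
  have "0 < ?D (Suc s) h"
    using Suc by (intro Suc.hyps(1)) auto
  \<comment> \<open>One of the two branches keeps \<open>h\<close> and is positive by induction;
    nonnegativity suffices for the other.\<close>
  moreover have "h(s := f s) = h \<or> h(s := Suc (f s)) = h"
    using h s by (metis fun_upd_triv)
  ultimately have "0 < ?D (Suc s) (h(s := f s)) \<or> 0 < ?D (Suc s) (h(s := Suc (f s)))"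
    by (elim disjE) (simp_all only: simp_thms)
  then show ?case
    unfolding eq using ab nn by (auto intro: add_pos_nonneg add_nonneg_pos)
qed

lemma tnn_add_rows:
  assumes "tnn (Suc m) n A" "a > 0" "b > 0"
  shows "tnn m n (\<lambda>p q. a * A p q + b * A (Suc p) q)"
  unfolding tnn_def using minor_of_row_sums[OF assms, where s = 0] by simp

lemma nonzero_minor_add_rows:
  assumes tnn: "tnn (Suc m) n A" and ab: "a > 0" "b > 0" and min: "nonzero_minor (Suc m) n A k" and k: "k \<le> m"
  shows "nonzero_minor m n (\<lambda>p q. a * A p q + b * A (Suc p) q) k"
proof -
  obtain h g where h: "incr k (Suc m) h" and g: "incr k n g" and D: "detf k (\<lambda>p q. A (h p) (g q)) \<noteq> 0"
    using min unfolding nonzero_minor_def by blast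
  have pos: "0 < detf k (\<lambda>p q. A (h p) (g q))"
    using tnn D g h unfolding tnn_def by (metis less_eq_real_def)
  have "card (h ` {..<k}) \<le> k" using card_image_le[of "{..<k}" h] by simp
  moreover have "card {..<Suc m} = Suc m" by simp
  ultimately have "\<not> {..<Suc m} \<subseteq> h ` {..<k}"
    using k card_mono[of "h ` {..<k}" "{..<Suc m}"] by auto
  \<comment> \<open>The \<open>k \<le> m\<close> selected rows among \<open>Suc m\<close> miss some
    row \<open>r\<close>. Lowering the selected indices beyond \<open>r\<close> by one closes this
    gap, so \<open>f\<close> fits into \<open>m\<close> rows and the original minor occurs in the
    expansion along \<open>f\<close>.\<close>
  then obtain r where r: "r < Suc m" "r \<notin> h ` {..<k}" by auto
  define f where "f t = (if h t < r then h t else h t - 1)" for t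
  have ne: "h t \<noteq> r" if "t < k" for t using r that by auto
  have f: "incr k m f"
    unfolding incr_def
  proof safe
    fix p assume p: "p < k"
    have "h p < Suc m" using h p by (simp add: incr_def)
    then show "f p < m" using r ne[OF p] by (auto simp: f_def)
  next
    fix p q assume "p < q" "q < k"
    then have "h p < h q" using h by (simp add: incr_def)
    then show "f p < f q" using ne[of p] ne[of q] \<open>p < q\<close> \<open>q < k\<close> by (auto simp: f_def)
  qed
  have "\<forall>t<k. h t = f t \<or> h t = Suc (f t)"
    using ne by (auto simp: f_def)
  from minor_of_row_sums_pos[OF tnn ab f g this pos, of 0] show ?thesis
    unfolding nonzero_minor_def using f g by (intro exI[of _ f] exI[of _ g]) auto
qed

text \<open>Row \<open>p\<close> stands for \<open>t^(m - 1 - p)\<close> and column \<open>q\<close>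
  for \<open>t^q\<close>: this is the Hankel matrix of \<open>c\<close> with its \<open>m\<close>
  rows in reverse order. The number of columns is left free.\<close>

definition toep :: "nat \<Rightarrow> (nat \<Rightarrow> real) \<Rightarrow> nat \<Rightarrow> nat \<Rightarrow> real" where
  "toep m c p q = c (m - 1 + q - p)"

lemma incr_bound: "incr k m f \<Longrightarrow> k \<le> m"
proof -
  assume f: "incr k m f"
  then have "inj_on f {..<k}"
    by (intro linorder_inj_onI') (fastforce simp: incr_def)
  moreover have "f ` {..<k} \<subseteq> {..<m}" using f by (auto simp: incr_def)
  ultimately show ?thesis using card_inj_on_le[of f "{..<k}" "{..<m}"] by simp
qed

lemma tnn_cong:
  assumes "\<And>p q. p < m \<Longrightarrow> q < n \<Longrightarrow> A p q = B p q"
  shows "tnn m n A \<longleftrightarrow> tnn m n B"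
proof -
  have "detf k (\<lambda>p q. A (f p) (g q)) = detf k (\<lambda>p q. B (f p) (g q))"
    if "incr k m f" "incr k n g" for k f g
    using that by (intro detf_cong assms) (auto simp: incr_def)
  then show ?thesis unfolding tnn_def by (simp cong: imp_cong)
qed

lemma nonzero_minor_cong:
  assumes "\<And>p q. p < m \<Longrightarrow> q < n \<Longrightarrow> A p q = B p q"
  shows "nonzero_minor m n A k \<longleftrightarrow> nonzero_minor m n B k"
proof -
  have "detf k (\<lambda>p q. A (f p) (g q)) = detf k (\<lambda>p q. B (f p) (g q))"
    if "incr k m f" "incr k n g" for f g
    using that by (intro detf_cong assms) (auto simp: incr_def)
  then show ?thesis unfolding nonzero_minor_def by (simp cong: conj_cong)
qed

text \<open>Going down one row lowers the index of \<open>c\<close> by one, so \<open>a\<close>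
  times a row plus \<open>b\<close> times the next one is a row of the Toeplitz matrix of the new
  sequence.\<close>

lemma toeplitz_remove_row:
  assumes "tnn (Suc m) n (toep (Suc m) c)" "a > 0" "b > 0"
  shows "tnn m n (toep m (\<lambda>k. b * c k + a * c (Suc k)))"
    and "nonzero_minor (Suc m) n (toep (Suc m) c) k \<Longrightarrow> k \<le> m \<Longrightarrow>
      nonzero_minor m n (toep m (\<lambda>k. b * c k + a * c (Suc k))) k"
proof -
  have *: "a * toep (Suc m) c p q + b * toep (Suc m) c (Suc p) q = toep m (\<lambda>k. b * c k + a * c (Suc k)) p q"
    if "p < m" "q < n" for p q
    using that by (simp add: toep_def Suc_diff_Suc[of p "m + q", simplified])
  show "tnn m n (toep m (\<lambda>k. b * c k + a * c (Suc k)))"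
    by (rule iffD1[OF tnn_cong, OF * tnn_add_rows[OF assms]])
  assume k: "nonzero_minor (Suc m) n (toep (Suc m) c) k" "k \<le> m"
  show "nonzero_minor m n (toep m (\<lambda>k. b * c k + a * c (Suc k))) k"
    by (rule iffD1[OF nonzero_minor_cong, OF * nonzero_minor_add_rows[OF assms k]])
qed

text \<open>Along a row the index of \<open>c\<close> grows, so in the transposed matrix the two
  coefficients change places.\<close>

lemma toeplitz_remove_col:
  assumes "tnn m (Suc n) (toep m c)" "a > 0" "b > 0"
  shows "tnn m n (toep m (\<lambda>k. b * c k + a * c (Suc k)))"
    and "nonzero_minor m (Suc n) (toep m c) k \<Longrightarrow> k \<le> n \<Longrightarrow>
      nonzero_minor m n (toep m (\<lambda>k. b * c k + a * c (Suc k))) k"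
proof -
  have *: "b * toep m c q p + a * toep m c q (Suc p) = toep m (\<lambda>k. b * c k + a * c (Suc k)) q p"
    if "p < n" "q < m" for p q
    using that by (simp add: toep_def Suc_diff_Suc[of q "m + p", simplified])
  have tr: "tnn (Suc n) m (\<lambda>p q. toep m c q p)"
    by (rule iffD2[OF tnn_transpose assms(1)])
  have "tnn n m (\<lambda>p q. toep m (\<lambda>k. b * c k + a * c (Suc k)) q p)"
    by (rule iffD1[OF tnn_cong, OF * tnn_add_rows[OF tr assms(3,2)]])
  then show "tnn m n (toep m (\<lambda>k. b * c k + a * c (Suc k)))"
    by (rule iffD1[OF tnn_transpose])
  assume k: "nonzero_minor m (Suc n) (toep m c) k" "k \<le> n"
  have h: "nonzero_minor (Suc n) m (\<lambda>p q. toep m c q p) k"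
    by (rule iffD2[OF nonzero_minor_transpose k(1)])
  have "nonzero_minor n m (\<lambda>p q. toep m (\<lambda>k. b * c k + a * c (Suc k)) q p) k"
    by (rule iffD1[OF nonzero_minor_cong, OF * nonzero_minor_add_rows[OF tr assms(3,2) h k(2)]])
  then show "nonzero_minor m n (toep m (\<lambda>k. b * c k + a * c (Suc k))) k"
    by (rule iffD1[OF nonzero_minor_transpose])
qed

section \<open>The functional of a sequence\<close>

definition ev :: "(nat \<Rightarrow> real) \<Rightarrow> real poly \<Rightarrow> real" where
  "ev c p = (\<Sum>k\<le>Polynomial.degree p. Polynomial.coeff p k * c k)"

text \<open>The transpose of multiplication by \<open>p\<close>: the sequence of the functional that
  sends \<open>q\<close> to \<open>ev c (p * q)\<close>, see \<open>ev_pact\<close>.\<close>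

definition pact :: "real poly \<Rightarrow> (nat \<Rightarrow> real) \<Rightarrow> nat \<Rightarrow> real" where
  "pact p c k = ev c (p * Polynomial.monom 1 k)"

text \<open>Unlike a strict degree bound, this also makes sense for \<open>n = 0\<close>, where it
  says \<open>p = 0\<close>; that case occurs when a rank is 0.\<close>

definition deglt :: "nat \<Rightarrow> real poly \<Rightarrow> bool" where
  "deglt n p \<longleftrightarrow> (\<forall>k\<ge>n. Polynomial.coeff p k = 0)"

lemma degree_less_imp_deglt: "Polynomial.degree p < n \<Longrightarrow> deglt n p"
  unfolding deglt_def by (auto intro: coeff_eq_0)

lemma deglt_Suc_iff: "deglt (Suc n) p \<longleftrightarrow> Polynomial.degree p \<le> n"
  unfolding deglt_def by (auto intro: coeff_eq_0 degree_le)

lemma deglt_mult: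
  assumes "Polynomial.degree p \<le> u" "deglt n q"
  shows "deglt (u + n) (p * q)"
  unfolding deglt_def
proof safe
  fix k assume k: "u + n \<le> k"
  have "Polynomial.coeff p i * Polynomial.coeff q (k - i) = 0" for i
  proof (cases "i \<le> u")
    case True
    then show ?thesis using assms(2) k by (simp add: deglt_def)
  next
    case False
    then show ?thesis using assms(1) by (simp add: coeff_eq_0)
  qed
  then show "Polynomial.coeff (p * q) k = 0"
    unfolding coeff_mult by (intro sum.neutral) blast
qed

lemma ev_eq_sum:
  assumes "deglt n p"
  shows "ev c p = (\<Sum>k<n. Polynomial.coeff p k * c k)"
proof -
  have "(\<Sum>k<n. Polynomial.coeff p k * c k) = (\<Sum>k<max n (Suc (Polynomial.degree p)). Polynomial.coeff p k * c k)"
    using assms by (intro sum.mono_neutral_left) (auto simp: deglt_def)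
  also have "\<dots> = ev c p"
    unfolding ev_def by (intro sum.mono_neutral_right) (auto intro: coeff_eq_0)
  finally show ?thesis ..
qed

lemma ev_add: "ev c (p + q) = ev c p + ev c q"
proof -
  define n where "n = Suc (max (Polynomial.degree p) (Polynomial.degree q))"
  have "deglt n p" "deglt n q" "deglt n (p + q)"
    unfolding n_def deglt_Suc_iff by (auto intro: degree_add_le)
  then show ?thesis by (simp add: ev_eq_sum[of n] sum.distrib algebra_simps)
qed

lemma ev_smult: "ev c (Polynomial.smult r p) = r * ev c p"
  by (subst ev_eq_sum[of "Suc (Polynomial.degree p)"])
    (auto simp: deglt_Suc_iff ev_def degree_smult_le sum_distrib_left lessThan_Suc_atMost algebra_simps)

lemma ev_0 [simp]: "ev c 0 = 0"
  by (simp add: ev_def)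

lemma ev_diff: "ev c (p - q) = ev c p - ev c q"
  using ev_add[of c "p - q" q] by simp

lemma ev_sum: "ev c (sum p A) = (\<Sum>x\<in>A. ev c (p x))"
  by (induction A rule: infinite_finite_induct) (auto simp: ev_add)

lemma poly_eq_sum_monom:
  fixes p :: "real poly"
  assumes "deglt n p"
  shows "p = (\<Sum>k<n. Polynomial.smult (Polynomial.coeff p k) (Polynomial.monom 1 k))"
  using assms by (intro poly_eqI) (auto simp: coeff_sum deglt_def if_distrib cong: if_cong)

lemma ev_mult_eq_sum:
  assumes "deglt n q"
  shows "ev c (p * q) = (\<Sum>k<n. Polynomial.coeff q k * pact p c k)"
  by (subst poly_eq_sum_monom[OF assms])
    (simp add: sum_distrib_left ev_sum ev_smult pact_def)

lemma ev_pact: "ev (pact p c) q = ev c (p * q)"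
  by (subst ev_mult_eq_sum[of "Suc (Polynomial.degree q)"], simp add: deglt_Suc_iff)
    (simp add: ev_def lessThan_Suc_atMost)

lemma pact_mult: "pact (p * q) c = pact p (pact q c)"
  by (auto simp: fun_eq_iff pact_def ev_pact mult_ac)

lemma ev_monom [simp]: "ev c (Polynomial.monom 1 k) = c k"
  by (subst ev_eq_sum[of "Suc k"])
    (auto simp: deglt_Suc_iff degree_monom_le if_distrib cong: if_cong)

lemma pact_1 [simp]: "pact 1 c = c"
  by (auto simp: pact_def)

lemma pact_linear: "pact [:b, a:] c = (\<lambda>k. b * c k + a * c (Suc k))"
proof
  fix k
  have "[:b, a:] * Polynomial.monom 1 k = Polynomial.smult b (Polynomial.monom 1 k) + Polynomial.smult a (Polynomial.monom 1 (Suc k))"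
    by (simp add: monom_Suc)
  then show "pact [:b, a:] c k = b * c k + a * c (Suc k)"
    by (simp only: pact_def ev_add ev_smult ev_monom)
qed

section \<open>Products of positive linear forms \<open>a x + b y\<close>, dehomogenised to
  \<open>[:b, a:]\<close>\<close>

definition poslin :: "real poly \<Rightarrow> bool" where
  "poslin l \<longleftrightarrow> (\<exists>a b. a > 0 \<and> b > 0 \<and> l = [:b, a:])"

lemma poslinE:
  assumes "poslin l"
  obtains a b where "a > 0" "b > 0" "l = [:b, a:]"
  using assms unfolding poslin_def by blast

lemma degree_poslin: "poslin l \<Longrightarrow> Polynomial.degree l = 1"
  by (auto elim!: poslinE)

lemma degree_prod_poslin:
  assumes "\<And>s. s \<in> S \<Longrightarrow> poslin (l s)" "finite S"
  shows "Polynomial.degree (prod l S) \<le> card S"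
proof -
  have "Polynomial.degree (prod l S) \<le> (\<Sum>s\<in>S. Polynomial.degree (l s))"
    using degree_prod_sum_le[OF assms(2)] by (simp add: o_def)
  also have "\<dots> \<le> (\<Sum>s\<in>S. 1)"
    using assms(1) by (intro sum_mono) (simp add: degree_poslin)
  finally show ?thesis by simp
qed

text \<open>The forms with index below \<open>v\<close> cost a column each, the other
  \<open>u\<close> a row each, and the form of largest index acts first. A nonzero minor of size
  \<open>k\<close> survives because at least \<open>k\<close> rows and columns remain at every
  stage.\<close>

lemma toeplitz_prod:
  assumes l: "\<And>s. poslin (l s)" and tnn: "tnn (m + u) (n + v) (toep (m + u) c)"
  shows "tnn m n (toep m (pact (\<Prod>s<u + v. l s) c)) \<and>
    (nonzero_minor (m + u) (n + v) (toep (m + u) c) k \<longrightarrow> k \<le> m \<longrightarrow> k \<le> n \<longrightarrow>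
      nonzero_minor m n (toep m (pact (\<Prod>s<u + v. l s) c)) k)"
  using tnn
proof (induction u arbitrary: c)
  case 0
  then show ?case
  proof (induction v arbitrary: c)
    case (Suc v)
    obtain a b where ab: "a > 0" "b > 0" "l v = [:b, a:]" using l[of v] by (rule poslinE)
    have t: "tnn m (Suc (n + v)) (toep m c)" using Suc.prems by simp
    note col = toeplitz_remove_col[OF t ab(1,2), folded pact_linear, folded ab(3)]
    have "pact (\<Prod>s<Suc v. l s) c = pact (\<Prod>s<v. l s) (pact (l v) c)"
      by (simp add: pact_mult)
    then show ?case
      using Suc.IH[of "pact (l v) c"] col(1) col(2)[of k] by simp
  qed simp
next
  case (Suc u)
  obtain a b where ab: "a > 0" "b > 0" "l (u + v) = [:b, a:]" using l[of "u + v"] by (rule poslinE)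
  have t: "tnn (Suc (m + u)) (n + v) (toep (Suc (m + u)) c)" using Suc.prems by simp
  note row = toeplitz_remove_row[OF t ab(1,2), folded pact_linear, folded ab(3)]
  have "pact (\<Prod>s<Suc u + v. l s) c = pact (\<Prod>s<u + v. l s) (pact (l (u + v)) c)"
    by (simp add: pact_mult)
  then show ?case
    using Suc.IH[of "pact (l (u + v)) c"] row(1) row(2)[of k] by simp
qed

lemma incr_same:
  assumes "incr k k f" "p < k"
  shows "f p = p"
proof -
  have ge: "p \<le> f p" if "p < k" for p
    using that
  proof (induction p)
    case (Suc p)
    then have "f p < f (Suc p)" using assms(1) by (simp add: incr_def)
    then show ?case using Suc by simp
  qed simp
  have le: "f (k - 1 - p) \<le> k - 1 - p" if "p < k" for p
    using that
  proof (induction p)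
    case 0
    then have "f (k - 1) < k" using assms(1) by (simp add: incr_def)
    then show ?case using 0 by simp
  next
    case (Suc p)
    then have "f (k - 1 - Suc p) < f (k - 1 - p)" using assms(1) by (simp add: incr_def)
    then show ?case using Suc by simp
  qed
  show ?thesis
    using ge[OF assms(2)] le[of "k - 1 - p"] assms(2) by simp
qed

text \<open>Spend \<open>m - k\<close> of the forms on rows and \<open>n - k\<close> on columns; the
  only minor of size \<open>k\<close> left is the whole matrix.\<close>

lemma toeplitz_prod_det_pos:
  assumes l: "\<And>s. poslin (l s)" and tnn: "tnn m n (toep m c)" and min: "nonzero_minor m n (toep m c) k"
    and N: "N + 2 * k = m + n"
  shows "0 < detf k (toep k (pact (\<Prod>s<N. l s) c))"
proof -
  let ?A = "toep k (pact (\<Prod>s<N. l s) c)"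
  have km: "k \<le> m" "k \<le> n"
    using min unfolding nonzero_minor_def by (auto dest: incr_bound)
  then have eq: "k + (m - k) = m" "k + (n - k) = n" "m - k + (n - k) = N" using N by auto
  have *: "tnn k k ?A" "nonzero_minor k k ?A k"
    using toeplitz_prod[OF l, where m = k and u = "m - k" and n = k and v = "n - k" and c = c and k = k] tnn min
    unfolding eq by auto
  then obtain f g where fg: "incr k k f" "incr k k g" "detf k (\<lambda>p q. ?A (f p) (g q)) \<noteq> 0"
    unfolding nonzero_minor_def by blast
  have "detf k (\<lambda>p q. ?A (f p) (g q)) = detf k ?A"
    by (rule detf_cong) (simp add: incr_same[OF fg(1)] incr_same[OF fg(2)])
  moreover have "0 \<le> detf k (\<lambda>p q. ?A (f p) (g q))"
    using *(1) fg unfolding tnn_def by blast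
  ultimately show ?thesis using fg(3) by simp
qed

section \<open>The pairing of polynomials given by \<open>ev\<close>, and its sign on primitive
  elements\<close>

lemma toep_nondegenerate:
  assumes det: "detf k (toep k c) \<noteq> 0" and deg: "deglt k \<gamma>"
    and orth: "\<And>p. p < k \<Longrightarrow> ev c (Polynomial.monom 1 p * \<gamma>) = 0"
  shows "\<gamma> = 0"
proof (rule ccontr)
  assume "\<gamma> \<noteq> 0"
  then obtain q where q: "Polynomial.coeff \<gamma> q \<noteq> 0"
    by (auto simp: poly_eq_iff)
  then have "q < k" using deg unfolding deglt_def by (meson not_le)
  \<comment> \<open>Pairing with \<open>t^(k - 1 - p)\<close> is row \<open>p\<close> of the matrix,
    so the coefficient vector of \<open>\<gamma>\<close> lies in its kernel.\<close>
  moreover have "(\<Sum>q<k. toep k c p q * Polynomial.coeff \<gamma> q) = 0" if "p < k" for p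
  proof -
    have "ev c (Polynomial.monom 1 (k - 1 - p) * \<gamma>) = (\<Sum>q<k. Polynomial.coeff \<gamma> q * pact (Polynomial.monom 1 (k - 1 - p)) c q)"
      by (rule ev_mult_eq_sum[OF deg])
    also have "\<dots> = (\<Sum>q<k. toep k c p q * Polynomial.coeff \<gamma> q)"
      using that by (intro sum.cong) (auto simp: pact_def mult_monom toep_def)
    finally show ?thesis using orth[of "k - 1 - p"] that by simp
  qed
  ultimately have "detf k (toep k c) = 0"
    unfolding detf_eq_0_iff using q by blast
  with det show False by simp
qed

text \<open>The Gram determinant of \<open>\<alpha>\<close>, \<open>l\<close>, \<open>l t\<close>,
  ..., \<open>l t^(j - 1)\<close> is evaluated twice. As a base change of the Toeplitz matrix it is
  positive; by primitivity it is \<open>ev g (\<alpha> * \<alpha>)\<close> times a smaller positive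
  determinant, up to the sign \<open>(-1)^j\<close> caused by the reversed rows.\<close>

lemma primitive_sign:
  fixes \<alpha> l :: "real poly"
  assumes det: "0 < detf (Suc j) (toep (Suc j) g)"
    and det0: "0 < detf j (toep j (pact (l * l) g))"
    and l: "poslin l" and \<alpha>: "Polynomial.degree \<alpha> \<le> j" "\<alpha> \<noteq> 0"
    and prim: "\<And>k. k < j \<Longrightarrow> ev g (l * \<alpha> * Polynomial.monom 1 k) = 0"
  shows "0 < (-1) ^ j * ev g (\<alpha> * \<alpha>)"
proof -
  define s where "s q = (case q of 0 \<Rightarrow> \<alpha> | Suc q \<Rightarrow> l * Polynomial.monom 1 q)" for q
  have s0: "s 0 = \<alpha>" and sS: "s (Suc q) = l * Polynomial.monom 1 q" for q
    by (auto simp: s_def)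
  have dl: "Polynomial.degree l \<le> 1" "l \<noteq> 0" using l by (auto simp: poslin_def)
  have deg: "deglt (Suc j) (s q)" if "q < Suc j" for q
  proof (cases q)
    case 0
    then show ?thesis using \<alpha> by (simp add: s0 deglt_Suc_iff)
  next
    case (Suc r)
    have "Polynomial.degree (s q) \<le> 1 + r"
      unfolding Suc sS using dl(1) degree_monom_le[of "1::real" r]
      by (intro order.trans[OF degree_mult_le] add_mono)
    then show ?thesis using that Suc by (simp add: deglt_Suc_iff)
  qed
  define S where "S w q = Polynomial.coeff (s q) w" for w q
  define U where "U p v = Polynomial.coeff (s (j - p)) (j - v)" for p v
  define N where "N p q = ev g (s (j - p) * s q)" for p q
    \<comment> \<open>the Gram matrix of the basis \<open>s\<close>; its rows are reversed to match the Toeplitz shape\<close>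
  have "detf (Suc j) U = detf (Suc j) (\<lambda>p q. (\<lambda>p q. S q p) (Suc j - 1 - p) (Suc j - 1 - q))"
    by (rule detf_cong) (simp add: U_def S_def)
  also have "\<dots> = detf (Suc j) S"
    by (subst detf_reverse) (rule detf_transpose)
  finally have US: "detf (Suc j) U = detf (Suc j) S" .
  have "N p q = (\<Sum>v<Suc j. U p v * (\<Sum>w<Suc j. toep (Suc j) g v w * S w q))" if "p < Suc j" "q < Suc j" for p q
  proof -
    have "N p q = (\<Sum>w<Suc j. S w q * pact (s (j - p)) g w)"
      unfolding N_def S_def by (rule ev_mult_eq_sum[OF deg[OF that(2)]])
    also have "\<dots> = (\<Sum>w<Suc j. S w q * (\<Sum>v<Suc j. Polynomial.coeff (s (j - p)) v * g (v + w)))"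
    proof (rule sum.cong[OF refl])
      fix w
      have "pact (s (j - p)) g w = ev g (Polynomial.monom 1 w * s (j - p))"
        by (simp add: pact_def mult.commute)
      also have "\<dots> = (\<Sum>v<Suc j. Polynomial.coeff (s (j - p)) v * pact (Polynomial.monom 1 w) g v)"
        by (rule ev_mult_eq_sum) (rule deg, simp)
      finally show "S w q * pact (s (j - p)) g w = S w q * (\<Sum>v<Suc j. Polynomial.coeff (s (j - p)) v * g (v + w))"
        by (simp add: pact_def mult_monom add.commute)
    qed
    also have "\<dots> = (\<Sum>v<Suc j. Polynomial.coeff (s (j - p)) v * (\<Sum>w<Suc j. g (v + w) * S w q))"
      unfolding sum_distrib_left by (subst sum.swap) (simp add: mult_ac)
    \<comment> \<open>Replacing \<open>v\<close> by \<open>j - v\<close> turns the Hankel entries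
      \<open>g (v + w)\<close> into Toeplitz ones.\<close>
    also have "\<dots> = (\<Sum>v<Suc j. Polynomial.coeff (s (j - p)) (Suc j - Suc v) * (\<Sum>w<Suc j. g (Suc j - Suc v + w) * S w q))"
      by (rule sum.nat_diff_reindex[symmetric])
    also have "\<dots> = (\<Sum>v<Suc j. U p v * (\<Sum>w<Suc j. toep (Suc j) g v w * S w q))"
      by (intro sum.cong refl arg_cong2[of _ _ _ _ "(*)"]) (auto simp: U_def toep_def)
    finally show ?thesis .
  qed
  then have "detf (Suc j) N = detf (Suc j) (\<lambda>p q. (\<Sum>v<Suc j. U p v * (\<Sum>w<Suc j. toep (Suc j) g v w * S w q)))"
    by (rule detf_cong)
  then have det_N: "detf (Suc j) N = detf (Suc j) S * detf (Suc j) S * detf (Suc j) (toep (Suc j) g)"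
    unfolding detf_mult US by simp
  have "detf (Suc j) S \<noteq> 0"
  proof
    assume "detf (Suc j) S = 0"
    then obtain v where v: "\<exists>q<Suc j. v q \<noteq> 0" "\<forall>p<Suc j. (\<Sum>q<Suc j. S p q * v q) = 0"
      unfolding detf_eq_0_iff by blast
    \<comment> \<open>A linear relation in the basis reads
      \<open>v 0 \<alpha> + l \<beta> = 0\<close>. Pairing it with \<open>l t^k\<close> removes the
      first term by primitivity, and nondegeneracy for \<open>pact (l * l) g\<close> then gives
      \<open>\<beta> = 0\<close>.\<close>
    define \<beta> where "\<beta> = (\<Sum>q<j. Polynomial.smult (v (Suc q)) (Polynomial.monom 1 q))"
    have cb: "Polynomial.coeff \<beta> q = (if q < j then v (Suc q) else 0)" for q
      by (auto simp: \<beta>_def coeff_sum if_distrib cong: if_cong)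
    have "(\<Sum>q<Suc j. Polynomial.smult (v q) (s q)) = 0"
    proof (rule poly_eqI)
      fix p
      show "Polynomial.coeff (\<Sum>q<Suc j. Polynomial.smult (v q) (s q)) p = Polynomial.coeff 0 p"
      proof (cases "p < Suc j")
        case True
        then show ?thesis using v(2) by (simp add: coeff_sum S_def mult.commute del: sum.lessThan_Suc)
      next
        case False
        then have "Polynomial.coeff (s q) p = 0" if "q < Suc j" for q
          using deg[OF that] by (simp add: deglt_def)
        then show ?thesis by (simp add: coeff_sum del: sum.lessThan_Suc)
      qed
    qed
    also have "(\<Sum>q<Suc j. Polynomial.smult (v q) (s q)) = Polynomial.smult (v 0) \<alpha> + l * \<beta>"
      unfolding sum.lessThan_Suc_shift \<beta>_def s0 sS by (simp add: sum_distrib_left)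
    finally have z: "Polynomial.smult (v 0) \<alpha> + l * \<beta> = 0" .
    have "\<beta> = 0"
    proof (rule toep_nondegenerate[of j "pact (l * l) g"])
      show "detf j (toep j (pact (l * l) g)) \<noteq> 0" using det0 by simp
      show "deglt j \<beta>" by (simp add: deglt_def cb)
      fix k assume k: "k < j"
      have "0 = ev g (l * Polynomial.monom 1 k * (Polynomial.smult (v 0) \<alpha> + l * \<beta>))"
        by (simp add: z)
      also have "\<dots> = v 0 * ev g (l * \<alpha> * Polynomial.monom 1 k) + ev g (l * l * (Polynomial.monom 1 k * \<beta>))"
        by (simp add: distrib_left ev_add ev_smult mult_ac)
      finally show "ev (pact (l * l) g) (Polynomial.monom 1 k * \<beta>) = 0"
        using prim[OF k] by (simp add: ev_pact)
    qed
    then have "v (Suc q) = 0" if "q < j" for q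
      using cb[of q] that by simp
    moreover have "v 0 = 0" using z \<open>\<beta> = 0\<close> \<alpha>(2) by simp
    ultimately show False using v(1) by (metis less_Suc_eq_0_disj)
  qed
  then have pos: "0 < detf (Suc j) N"
    unfolding det_N using det by (auto simp: zero_less_mult_iff linorder_neq_iff)
  let ?M = "mat (Suc j) (Suc j) (\<lambda>(p, q). N p q)"
  \<comment> \<open>Except in the last row, column 0 pairs \<open>\<alpha>\<close> with some
    \<open>l t^r\<close>, \<open>r < j\<close>, so a single entry is left for the Laplace
    expansion.\<close>
  have N0: "N p 0 = 0" if "p < j" for p
  proof -
    have "j - p = Suc (j - p - 1)" using that by simp
    then have "N p 0 = ev g (l * \<alpha> * Polynomial.monom 1 (j - p - 1))"
      unfolding N_def s0 by (metis sS mult.assoc mult.commute)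
    then show ?thesis using prim[of "j - p - 1"] that by simp
  qed
  have "detf (Suc j) N = (\<Sum>i<Suc j. ?M $$ (i, 0) * cofactor ?M i 0)"
    unfolding detf_def by (rule laplace_expansion_column) auto
  also have "\<dots> = N j 0 * cofactor ?M j 0"
    using N0 by (simp add: sum.neutral)
  also have "cofactor ?M j 0 = (-1) ^ j * detf j (\<lambda>p q. N p (Suc q))"
    unfolding cofactor_def detf_def
    by (simp add: mat_delete_def, intro disjI2 arg_cong[of _ _ det] eq_matI) auto
  also have "detf j (\<lambda>p q. N p (Suc q)) = detf j (toep j (pact (l * l) g))"
  proof (rule detf_cong)
    fix p q assume pq: "p < j" "q < j"
    then have sp: "s (j - p) = l * Polynomial.monom 1 (j - 1 - p)"
      using sS[of "j - 1 - p"] by (simp add: Suc_diff_Suc)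
    have "N p (Suc q) = ev g (l * l * (Polynomial.monom 1 (j - 1 - p) * Polynomial.monom 1 q))"
      unfolding N_def sp sS by (simp only: mult_ac)
    then show "N p (Suc q) = toep j (pact (l * l) g) p q"
      using pq by (simp add: toep_def pact_def mult_monom)
  qed
  also have "N j 0 = ev g (\<alpha> * \<alpha>)" by (simp add: N_def s0)
  finally have "0 < ((-1) ^ j * ev g (\<alpha> * \<alpha>)) * detf j (toep j (pact (l * l) g))"
    using pos by (simp add: mult_ac)
  then show ?thesis using det0 by (simp add: zero_less_mult_iff)
qed

section \<open>Toeplitz matrices of low rank\<close>

lemma detf_solve:
  assumes "detf k R \<noteq> 0"
  shows "\<exists>v. \<forall>p<k. (\<Sum>q<k. R p q * v q) = y p"
proof -
  let ?M = "mat k k (\<lambda>(p, q). R p q)"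
  define v where "v q = (\<Sum>s<k. adj_mat ?M $$ (q, s) * y s) / detf k R" for q
  have adj: "adj_mat ?M \<in> carrier_mat k k" "?M * adj_mat ?M = detf k R \<cdot>\<^sub>m 1\<^sub>m k"
    using adj_mat[of ?M k] by (auto simp: detf_def)
  have "(\<Sum>q<k. R p q * v q) = y p" if p: "p < k" for p
  proof -
    have *: "(\<Sum>q<k. R p q * adj_mat ?M $$ (q, s)) = (if p = s then detf k R else 0)" if "s < k" for s
    proof -
      have "(\<Sum>q<k. R p q * adj_mat ?M $$ (q, s)) = (?M * adj_mat ?M) $$ (p, s)"
        using p that adj(1) by (auto simp: scalar_prod_def lessThan_atLeast0 intro!: sum.cong)
      then show ?thesis using p that unfolding adj(2) by simp
    qed
    have "(\<Sum>q<k. R p q * v q) = (\<Sum>q<k. \<Sum>s<k. R p q * adj_mat ?M $$ (q, s) * (y s / detf k R))"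
      unfolding v_def by (simp add: sum_distrib_left sum_divide_distrib mult.assoc)
    also have "\<dots> = (\<Sum>s<k. (\<Sum>q<k. R p q * adj_mat ?M $$ (q, s)) * (y s / detf k R))"
      unfolding sum_distrib_right by (rule sum.swap)
    also have "\<dots> = (\<Sum>s<k. if p = s then y s else 0)"
      using * assms by (intro sum.cong) auto
    finally show ?thesis using p by simp
  qed
  then show ?thesis by blast
qed

text \<open>The kernel criterion sees only the set of rows, so the sign of a permutation never has
  to be computed.\<close>

lemma detf_rows_eq_0_cong:
  assumes "f ` {..<k} = h ` {..<k}"
  shows "detf k (\<lambda>p q. A (f p) q) = 0 \<longleftrightarrow> detf k (\<lambda>p q. A (h p) q) = 0"
proof -
  have "(\<forall>p<k. P (f p)) \<longleftrightarrow> (\<forall>p<k. P (h p))" for P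
  proof -
    have "(\<forall>x\<in>f ` {..<k}. P x) \<longleftrightarrow> (\<forall>x\<in>h ` {..<k}. P x)" unfolding assms ..
    then show ?thesis by auto
  qed
  from this[of "\<lambda>x. (\<Sum>q<k. A x q * v q) = 0" for v] show ?thesis
    unfolding detf_eq_0_iff by simp
qed

lemma ex_incr_image:
  assumes inj: "inj_on f {..<k}" and f: "\<And>p. p < k \<Longrightarrow> f p < m"
  obtains h where "incr k m h" "f ` {..<k} = h ` {..<k}"
proof -
  define xs where "xs = sorted_list_of_set (f ` {..<k})"
  have len: "length xs = k"
    unfolding xs_def using card_image[OF inj] by simp
  have set: "set xs = f ` {..<k}"
    unfolding xs_def by simp
  have sorted: "sorted_wrt (<) xs"
    unfolding xs_def by simp
  have "incr k m (\<lambda>p. xs ! p)"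
    unfolding incr_def
  proof safe
    fix p assume "p < k"
    then have "xs ! p \<in> f ` {..<k}" using len set nth_mem[of p xs] by simp
    then show "xs ! p < m" using f by auto
  next
    fix p q assume "p < q" "q < k"
    then show "xs ! p < xs ! q" using sorted len by (simp add: sorted_wrt_nth_less)
  qed
  moreover have "f ` {..<k} = (\<lambda>p. xs ! p) ` {..<k}"
    by (simp only: set[symmetric] set_conv_nth len) auto
  ultimately show ?thesis by (rule that)
qed

text \<open>Extends the vanishing from increasing selections to all: a repeated index gives equal
  rows or columns, and distinct indices can be sorted without affecting whether the determinant is
  zero.\<close>

lemma minor_eq_0:
  assumes no: "\<not> nonzero_minor m n A k" and f: "\<And>p. p < k \<Longrightarrow> f p < m" and g: "\<And>q. q < k \<Longrightarrow> g q < n"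
  shows "detf k (\<lambda>p q. A (f p) (g q)) = 0"
proof -
  have noninj: "detf k (\<lambda>p q. B (f p) q) = 0" if "\<not> inj_on f {..<k}" for B :: "nat \<Rightarrow> nat \<Rightarrow> real" and f
  proof -
    from that obtain p q where "p < k" "q < k" "p \<noteq> q" "f p = f q"
      by (auto simp: inj_on_def)
    then show ?thesis by (intro detf_identical_rows[of p k q]) auto
  qed
  have tr: "detf k (\<lambda>p q. A (h p) (g q)) = detf k (\<lambda>p q. A (h q) (g p))" for h g
    by (rule detf_transpose)
  show ?thesis
  proof (cases "inj_on f {..<k} \<and> inj_on g {..<k}")
    case True
    obtain f' where f': "incr k m f'" "f ` {..<k} = f' ` {..<k}"
      using True f by (blast intro: ex_incr_image)
    obtain g' where g': "incr k n g'" "g ` {..<k} = g' ` {..<k}"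
      using True g by (blast intro: ex_incr_image)
    have "detf k (\<lambda>p q. A (f' p) (g' q)) = 0"
      using no f' g' unfolding nonzero_minor_def by blast
    then have "detf k (\<lambda>p q. A (f p) (g' q)) = 0"
      using detf_rows_eq_0_cong[OF f'(2), of "\<lambda>p q. A p (g' q)"] by simp
    then have "detf k (\<lambda>p q. A (f p) (g q)) = 0"
      using detf_rows_eq_0_cong[OF g'(2), of "\<lambda>p q. A (f q) p"] unfolding tr[of f] by simp
    then show ?thesis .
  next
    case False
    then show ?thesis
      using noninj[of f "\<lambda>p q. A p (g q)"] noninj[of g "\<lambda>p q. A (f q) p"] tr[of f g] by auto
  qed
qed

text \<open>The weights \<open>w\<close> are found on the columns \<open>g\<close> alone. For any
  column \<open>y\<close>, bordering the minor with row \<open>p\<close> and column \<open>y\<close>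
  gives determinant zero, and the resulting relation between rows is, by its values on
  \<open>g\<close>, a multiple of the one given by \<open>w\<close>.\<close>

lemma row_combination:
  assumes f: "incr k m f" and g: "incr k n g" and min: "detf k (\<lambda>p q. A (f p) (g q)) \<noteq> 0"
    and no: "\<not> nonzero_minor m n A (Suc k)" and p: "p < m"
  shows "\<exists>w. \<forall>q<n. A p q = (\<Sum>u<k. w u * A (f u) q)"
proof -
  have min': "detf k (\<lambda>q u. A (f u) (g q)) \<noteq> 0"
    using min by (subst detf_transpose)
  have unique: "\<forall>u<k. v u = 0" if "\<forall>q<k. (\<Sum>u<k. A (f u) (g q) * v u) = 0" for v
    using min' that unfolding detf_eq_0_iff by blast
  obtain w where w: "\<forall>q<k. (\<Sum>u<k. A (f u) (g q) * w u) = A p (g q)"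
    using detf_solve[OF min', of "\<lambda>q. A p (g q)"] by (elim exE)
  have "A p y = (\<Sum>u<k. w u * A (f u) y)" if y: "y < n" for y
  proof -
    define f' where "f' u = (if u < k then f u else p)" for u
    define g' where "g' u = (if u < k then g u else y)" for u
    have "detf (Suc k) (\<lambda>u q. A (f' u) (g' q)) = 0"
      using f g p y by (intro minor_eq_0[OF no]) (auto simp: f'_def g'_def incr_def)
    then have "detf (Suc k) (\<lambda>q u. A (f' u) (g' q)) = 0"
      by (subst detf_transpose)
    then obtain z where z: "\<exists>u<Suc k. z u \<noteq> 0" "\<forall>q<Suc k. (\<Sum>u<Suc k. A (f' u) (g' q) * z u) = 0"
      unfolding detf_eq_0_iff by blast
    have zq: "(\<Sum>u<k. A (f u) (g q) * z u) + A p (g q) * z k = 0" if "q < k" for q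
      using z(2)[rule_format, of q] that by (simp add: f'_def g'_def)
    have zy: "(\<Sum>u<k. A (f u) y * z u) + A p y * z k = 0"
      using z(2)[rule_format, of k] by (simp add: f'_def g'_def)
    have "(\<Sum>u<k. A (f u) (g q) * (z u + z k * w u)) = 0" if "q < k" for q
      using zq[OF that] w[rule_format, OF that, symmetric]
      by (simp add: distrib_left sum.distrib sum_distrib_left sum_distrib_right mult_ac)
    then have eq: "z u = - z k * w u" if "u < k" for u
      using unique[of "\<lambda>u. z u + z k * w u"] that by (simp add: add_eq_0_iff2)
    then have "z k \<noteq> 0" using z(1) by (auto simp: less_Suc_eq)
    have "(\<Sum>u<k. A (f u) y * z u) = - z k * (\<Sum>u<k. w u * A (f u) y)"
      using eq by (simp add: sum_distrib_left mult_ac cong: sum.cong_simp)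
    with zy have "z k * (A p y - (\<Sum>u<k. w u * A (f u) y)) = 0"
      by (simp add: algebra_simps)
    with \<open>z k \<noteq> 0\<close> show ?thesis by simp
  qed
  then show ?thesis by blast
qed

lemma ev_linear_mult:
  "ev c ([:b, a:] * p * Polynomial.monom 1 q) =
    b * ev c (p * Polynomial.monom 1 q) + a * ev c (p * Polynomial.monom 1 (Suc q))"
proof -
  have "[:b, a:] * p * Polynomial.monom 1 q =
      Polynomial.smult b (p * Polynomial.monom 1 q) + Polynomial.smult a (p * Polynomial.monom 1 (Suc q))"
    by (simp add: monom_Suc algebra_simps)
  then show ?thesis by (simp only: ev_add ev_smult)
qed

text \<open>The low-rank case, with \<open>k\<close> the rank of the matrix expressed through its
  minors.\<close>

locale toeplitz_rank =
  fixes m n k :: nat and c :: "nat \<Rightarrow> real"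
  assumes tnn: "tnn m n (toep m c)" and min: "nonzero_minor m n (toep m c) k"
    and no: "\<not> nonzero_minor m n (toep m c) (Suc k)" and pos: "m > 0" "n > 0"
begin

lemma k_le: "k \<le> m" "k \<le> n"
  using min unfolding nonzero_minor_def by (auto dest: incr_bound)

text \<open>Multiply by \<open>n - k\<close> more forms: all \<open>m + n - 2 * k\<close> together
  give a nonsingular \<open>k\<close> by \<open>k\<close> Toeplitz matrix, and the added product
  times \<open>t^p\<close>, \<open>p < k\<close>, has degree below \<open>n\<close>, within reach of
  \<open>orth\<close>.\<close>

lemma product_nondegenerate:
  assumes l: "\<And>s. poslin (l s)" and deg: "deglt k \<gamma>"
    and orth: "\<And>q. q < n \<Longrightarrow> ev c ((\<Prod>s<m - k. l s) * \<gamma> * Polynomial.monom 1 q) = 0"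
  shows "\<gamma> = 0"
proof -
  define L' where "L' = (\<Prod>s\<in>{m - k..<m + n - 2 * k}. l s)"
  have prod: "(\<Prod>s<m + n - 2 * k. l s) = (\<Prod>s<m - k. l s) * L'"
    unfolding L'_def lessThan_atLeast0 using k_le
    by (subst prod.atLeastLessThan_concat) auto
  have degL: "Polynomial.degree L' \<le> n - k"
    using degree_prod_poslin[of "{m - k..<m + n - 2 * k}" l] l k_le by (simp add: L'_def)
  have "0 < detf k (toep k (pact (\<Prod>s<m + n - 2 * k. l s) c))"
    using k_le by (intro toeplitz_prod_det_pos[OF l tnn min]) auto
  then show ?thesis
  proof (intro toep_nondegenerate[OF _ deg])
    fix p assume p: "p < k"
    have "deglt n (L' * Polynomial.monom 1 p)"
    proof (rule degree_less_imp_deglt)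
      have "Polynomial.degree (L' * Polynomial.monom 1 p) \<le> (n - k) + p"
        using degL degree_monom_le[of "1::real" p]
        by (intro order.trans[OF degree_mult_le] add_mono)
      then show "Polynomial.degree (L' * Polynomial.monom 1 p) < n" using p k_le by simp
    qed
    then have "ev c ((\<Prod>s<m - k. l s) * \<gamma> * (L' * Polynomial.monom 1 p)) = 0"
      using orth by (subst ev_mult_eq_sum[of n]) (auto simp: pact_def intro!: sum.neutral)
    then show "ev (pact (\<Prod>s<m + n - 2 * k. l s) c) (Polynomial.monom 1 p * \<gamma>) = 0"
      unfolding ev_pact prod by (simp only: mult_ac)
  qed simp
qed

text \<open>A dimension count: as functionals on degree below \<open>n\<close>, the polynomials of
  degree below \<open>m\<close> span a space of dimension at most \<open>k\<close>, and by
  \<open>product_nondegenerate\<close> the multiples of the product by polynomials of degree below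
  \<open>k\<close> already fill it.\<close>

lemma decomposition_base:
  assumes l: "\<And>s. poslin (l s)" and \<beta>: "deglt m \<beta>"
  shows "\<exists>\<gamma>. deglt k \<gamma> \<and> (\<forall>q<n. ev c ((\<beta> - (\<Prod>s<m - k. l s) * \<gamma>) * Polynomial.monom 1 q) = 0)"
proof -
  define L where "L = (\<Prod>s<m - k. l s)"
  obtain f g where fg: "incr k m f" "incr k n g" "detf k (\<lambda>p q. toep m c (f p) (g q)) \<noteq> 0"
    using min unfolding nonzero_minor_def by blast
  have "\<forall>p. \<exists>w. p < m \<longrightarrow> (\<forall>q<n. toep m c p q = (\<Sum>u<k. w u * toep m c (f u) q))"
    using row_combination[OF fg no] by blast
  then obtain W where W: "\<And>p q. p < m \<Longrightarrow> q < n \<Longrightarrow> toep m c p q = (\<Sum>u<k. W p u * toep m c (f u) q)"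
    by metis
  \<comment> \<open>A polynomial of degree below \<open>m\<close> acts as a combination of all rows,
    hence of the \<open>k\<close> rows \<open>f u\<close>.\<close>
  have comb: "\<exists>w. \<forall>q<n. ev c (\<delta> * Polynomial.monom 1 q) = (\<Sum>u<k. w u * toep m c (f u) q)" if \<delta>: "deglt m \<delta>" for \<delta>
  proof -
    have "ev c (\<delta> * Polynomial.monom 1 q) = (\<Sum>u<k. (\<Sum>s<m. Polynomial.coeff \<delta> s * W (m - 1 - s) u) * toep m c (f u) q)"
      if q: "q < n" for q
    proof -
      have "ev c (\<delta> * Polynomial.monom 1 q) = (\<Sum>s<m. Polynomial.coeff \<delta> s * c (s + q))"
        using ev_mult_eq_sum[OF \<delta>, of c "Polynomial.monom 1 q"]
        by (simp add: mult.commute[of \<delta>] pact_def mult_monom add.commute[of q])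
      also have "\<dots> = (\<Sum>s<m. Polynomial.coeff \<delta> s * toep m c (m - 1 - s) q)"
        by (intro sum.cong) (auto simp: toep_def add.commute)
      also have "\<dots> = (\<Sum>s<m. Polynomial.coeff \<delta> s * (\<Sum>u<k. W (m - 1 - s) u * toep m c (f u) q))"
        using W q by (intro sum.cong) auto
      also have "\<dots> = (\<Sum>u<k. (\<Sum>s<m. Polynomial.coeff \<delta> s * W (m - 1 - s) u) * toep m c (f u) q)"
        unfolding sum_distrib_left sum_distrib_right by (subst sum.swap) (simp add: mult_ac)
      finally show ?thesis .
    qed
    then show ?thesis
      by (intro exI[of _ "\<lambda>u. \<Sum>s<m. Polynomial.coeff \<delta> s * W (m - 1 - s) u"]) simp
  qed
  have degL: "Polynomial.degree L \<le> m - k"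
    using degree_prod_poslin[of "{..<m - k}" l] l by (simp add: L_def)
  have "deglt m (L * Polynomial.monom 1 p)" if "p < k" for p
  proof (rule degree_less_imp_deglt)
    have "Polynomial.degree (L * Polynomial.monom 1 p) \<le> (m - k) + p"
      using degL degree_monom_le[of "1::real" p]
      by (intro order.trans[OF degree_mult_le] add_mono)
    then show "Polynomial.degree (L * Polynomial.monom 1 p) < m" using that k_le by simp
  qed
  then have "\<forall>p. \<exists>w. p < k \<longrightarrow> (\<forall>q<n. ev c (L * Polynomial.monom 1 p * Polynomial.monom 1 q) = (\<Sum>u<k. w u * toep m c (f u) q))"
    using comb by blast
  then obtain C where C: "\<And>p q. p < k \<Longrightarrow> q < n \<Longrightarrow>
      ev c (L * Polynomial.monom 1 p * Polynomial.monom 1 q) = (\<Sum>u<k. C p u * toep m c (f u) q)"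
    by metis
  define \<Gamma> where "\<Gamma> v = (\<Sum>p<k. Polynomial.smult (v p) (Polynomial.monom 1 p))" for v :: "nat \<Rightarrow> real"
  have c\<Gamma>: "Polynomial.coeff (\<Gamma> v) p = (if p < k then v p else 0)" for v p
    by (auto simp: \<Gamma>_def coeff_sum if_distrib cong: if_cong)
  then have deg\<Gamma>: "deglt k (\<Gamma> v)" for v
    by (simp add: deglt_def)
  have ev\<Gamma>: "ev c (L * \<Gamma> v * Polynomial.monom 1 q) = (\<Sum>u<k. (\<Sum>p<k. C p u * v p) * toep m c (f u) q)"
    if q: "q < n" for v q
  proof -
    have "ev c (L * \<Gamma> v * Polynomial.monom 1 q) = (\<Sum>p<k. v p * ev c (L * Polynomial.monom 1 p * Polynomial.monom 1 q))"
      unfolding \<Gamma>_def by (simp add: sum_distrib_left sum_distrib_right ev_sum ev_smult)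
    also have "\<dots> = (\<Sum>p<k. v p * (\<Sum>u<k. C p u * toep m c (f u) q))"
      using C q by (intro sum.cong) auto
    also have "\<dots> = (\<Sum>u<k. (\<Sum>p<k. C p u * v p) * toep m c (f u) q)"
      unfolding sum_distrib_left sum_distrib_right by (subst sum.swap) (simp add: mult_ac)
    finally show ?thesis .
  qed
  \<comment> \<open>\<open>C\<close> holds the coordinates of \<open>L t^p\<close> in the rows
    \<open>f u\<close>; a kernel vector would give a nonzero \<open>\<Gamma> v\<close> forbidden by
    \<open>product_nondegenerate\<close>.\<close>
  have "detf k (\<lambda>u p. C p u) \<noteq> 0"
  proof
    assume "detf k (\<lambda>u p. C p u) = 0"
    then obtain v where v: "\<exists>p<k. v p \<noteq> 0" "\<forall>u<k. (\<Sum>p<k. C p u * v p) = 0"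
      unfolding detf_eq_0_iff by blast
    have "\<Gamma> v = 0"
    proof (rule product_nondegenerate[OF l deg\<Gamma>])
      fix q assume "q < n"
      then show "ev c ((\<Prod>s<m - k. l s) * \<Gamma> v * Polynomial.monom 1 q) = 0"
        using v(2) ev\<Gamma>[of q v] by (simp add: L_def)
    qed
    then have "v p = 0" if "p < k" for p using that c\<Gamma>[of v p] by simp
    then show False using v(1) by blast
  qed
  then have solve: "\<exists>v. \<forall>u<k. (\<Sum>p<k. C p u * v p) = w u" for w
    by (rule detf_solve)
  obtain w where w: "\<forall>q<n. ev c (\<beta> * Polynomial.monom 1 q) = (\<Sum>u<k. w u * toep m c (f u) q)"
    using comb[OF \<beta>] by (elim exE)
  obtain v where v: "\<forall>u<k. (\<Sum>p<k. C p u * v p) = w u" using solve[of w] by (elim exE)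
  have "ev c ((\<beta> - L * \<Gamma> v) * Polynomial.monom 1 q) = 0" if "q < n" for q
    using w v ev\<Gamma>[OF that, of v] that by (simp add: left_diff_distrib ev_diff)
  then show ?thesis using deg\<Gamma> unfolding L_def by blast
qed

text \<open>Induction on \<open>e\<close>, splitting off one form: corrected by an annihilating
  polynomial, \<open>\<beta>\<close> becomes divisible by the last form, and the degree bound of the
  quotient drops by one. Multiplying back needs the test powers \<open>q\<close> and
  \<open>Suc q\<close>, whence the bound \<open>q + e < n\<close>.\<close>

lemma decomposition:
  assumes l: "\<And>s. poslin (l s)" and k: "k < m" and \<beta>: "deglt (m + e) \<beta>"
  shows "\<exists>\<gamma>. deglt k \<gamma> \<and> (\<forall>q. q + e < n \<longrightarrow> ev c ((\<beta> - (\<Prod>s<m + e - k. l s) * \<gamma>) * Polynomial.monom 1 q) = 0)"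
  using \<beta>
proof (induction e arbitrary: \<beta>)
  case 0
  then show ?case using decomposition_base[OF l, of \<beta>] by simp
next
  case (Suc e)
  obtain a b where ab: "a > 0" "b > 0" "l (m + e - k) = [:b, a:]"
    using l by (blast elim: poslinE)
  define z where "z = - b / a"
  have lz: "poly (l (m + e - k)) z = 0" using ab by (simp add: z_def)
  have "deglt m 1" using pos by (intro degree_less_imp_deglt) simp
  then obtain \<gamma>0 where \<gamma>0: "deglt k \<gamma>0"
      "\<forall>q<n. ev c ((1 - (\<Prod>s<m - k. l (m + e - k)) * \<gamma>0) * Polynomial.monom 1 q) = 0"
    using decomposition_base[of "\<lambda>s. l (m + e - k)" 1] l by blast
  \<comment> \<open>Subtracting from 1 a multiple of a power of the form leaves the value 1 at its
    root \<open>z\<close>, as \<open>k < m\<close> makes the exponent positive. Since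
    \<open>\<kappa>\<close> pairs to 0 with every \<open>t^q\<close>, \<open>q < n\<close>,
    multiples of it may be added freely.\<close>
  define \<kappa> where "\<kappa> = 1 - (\<Prod>s<m - k. l (m + e - k)) * \<gamma>0"
  have \<kappa>: "poly \<kappa> z = 1" "\<forall>q<n. ev c (\<kappa> * Polynomial.monom 1 q) = 0"
    using k lz \<gamma>0(2) by (auto simp: \<kappa>_def)
  have "deglt m ((\<Prod>s<m - k. l (m + e - k)) * \<gamma>0)"
    using deglt_mult[OF degree_prod_poslin[of "{..<m - k}" "\<lambda>s. l (m + e - k)"] \<gamma>0(1)] l k by simp
  then have deg\<kappa>: "deglt (m + Suc e) \<kappa>"
    using \<open>deglt m 1\<close> by (simp add: \<kappa>_def deglt_def)
  define \<beta>' where "\<beta>' = \<beta> - Polynomial.smult (poly \<beta> z) \<kappa>"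
  have deg\<beta>': "deglt (m + Suc e) \<beta>'"
    using deg\<kappa> Suc.prems by (simp add: \<beta>'_def deglt_def)
  have "poly \<beta>' z = 0" by (simp add: \<beta>'_def \<kappa>)
  then obtain r where "\<beta>' = [:-z, 1:] * r"
    unfolding poly_eq_0_iff_dvd by (elim dvdE)
  moreover have "l (m + e - k) = Polynomial.smult a [:-z, 1:]"
    using ab by (simp add: z_def)
  ultimately obtain \<beta>'' where \<beta>'': "\<beta>' = l (m + e - k) * \<beta>''"
    using ab(1) by (intro that[of "Polynomial.smult (1 / a) r"]) (simp only: mult_smult_left mult_smult_right smult_smult, simp)
  have deg\<beta>'': "deglt (m + e) \<beta>''"
  proof (cases "\<beta>'' = 0")
    case False
    then have "Polynomial.degree \<beta>' = 1 + Polynomial.degree \<beta>''"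
      unfolding \<beta>'' using ab by (subst degree_mult_eq) auto
    then show ?thesis
      using deg\<beta>' by (intro degree_less_imp_deglt) (simp add: deglt_Suc_iff)
  qed (simp add: deglt_def)
  define L where "L = (\<Prod>s<m + e - k. l s)"
  obtain \<gamma> where \<gamma>: "deglt k \<gamma>" "\<And>q. q + e < n \<Longrightarrow> ev c ((\<beta>'' - L * \<gamma>) * Polynomial.monom 1 q) = 0"
    using Suc.IH[OF deg\<beta>''] unfolding L_def by blast
  have "ev c ((\<beta> - (\<Prod>s<m + Suc e - k. l s) * \<gamma>) * Polynomial.monom 1 q) = 0" if q: "q + Suc e < n" for q
  proof -
    have "(\<Prod>s<m + Suc e - k. l s) = L * l (m + e - k)"
      using k by (simp add: L_def Suc_diff_le)
    then have "\<beta> - (\<Prod>s<m + Suc e - k. l s) * \<gamma> = Polynomial.smult (poly \<beta> z) \<kappa> + l (m + e - k) * (\<beta>'' - L * \<gamma>)"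
      using \<beta>'' by (simp add: \<beta>'_def algebra_simps)
    moreover have "ev c (l (m + e - k) * (\<beta>'' - L * \<gamma>) * Polynomial.monom 1 q) =
        b * ev c ((\<beta>'' - L * \<gamma>) * Polynomial.monom 1 q) + a * ev c ((\<beta>'' - L * \<gamma>) * Polynomial.monom 1 (Suc q))"
      unfolding ab(3) by (rule ev_linear_mult)
    ultimately show ?thesis
      using \<kappa>(2) \<gamma>(2)[of q] \<gamma>(2)[of "Suc q"] q by (simp add: distrib_right ev_add ev_smult)
  qed
  then show ?case using \<gamma>(1) by blast
qed

text \<open>Duality: against degree at most \<open>j\<close>, every \<open>t^q\<close> in range
  equals some \<open>L L' \<gamma>\<close>, where \<open>L\<close> is the product in
  \<open>prim\<close>. So \<open>\<alpha>\<close> paired with \<open>t^q\<close> is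
  \<open>L \<alpha>\<close> paired with \<open>L' \<gamma>\<close>, which has degree below
  \<open>j\<close>, and \<open>prim\<close> applies.\<close>

lemma annihilator_cancel:
  assumes l: "\<And>s. poslin (l s)" and k: "k \<le> j" and j: "j < m" and mn: "m \<le> n"
    and \<alpha>: "Polynomial.degree \<alpha> \<le> j"
    and prim: "\<And>q. q < j \<Longrightarrow> ev c ((\<Prod>s<m + n - 1 - 2 * j. l s) * \<alpha> * Polynomial.monom 1 q) = 0"
    and q: "q + j < m + n - 1"
  shows "ev c (\<alpha> * Polynomial.monom 1 q) = 0"
proof -
  \<comment> \<open>This value makes the test range \<open>s + e < n\<close> exactly
    \<open>s \<le> j\<close>, the degrees in \<open>\<alpha>\<close>, and leaves
    \<open>j - k\<close> factors for \<open>L'\<close>.\<close>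
  define e where "e = n - 1 - j"
  have e: "m + e = m + n - 1 - j" using j mn by (simp add: e_def)
  define L where "L = (\<Prod>s<m + n - 1 - 2 * j. l s)"
  define L' where "L' = (\<Prod>s\<in>{m + n - 1 - 2 * j..<m + e - k}. l s)"
  have prod: "(\<Prod>s<m + e - k. l s) = L * L'"
    unfolding L_def L'_def lessThan_atLeast0 using k j e mn
    by (subst prod.atLeastLessThan_concat) auto
  have degL': "Polynomial.degree L' \<le> j - k"
    using degree_prod_poslin[of "{m + n - 1 - 2 * j..<m + e - k}" l] l k j e mn by (simp add: L'_def)
  have "deglt (m + e) (Polynomial.monom 1 q)"
    using q e degree_monom_le[of "1::real" q] by (intro degree_less_imp_deglt) simp
  then obtain \<gamma> where \<gamma>: "deglt k \<gamma>"
      "\<And>s. s + e < n \<Longrightarrow> ev c ((Polynomial.monom 1 q - L * L' * \<gamma>) * Polynomial.monom 1 s) = 0"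
    using decomposition[where l = l and e = e and \<beta> = "Polynomial.monom 1 q"] l k j unfolding prod by auto
  have "ev c ((Polynomial.monom 1 q - L * L' * \<gamma>) * \<alpha>) = 0"
    using \<alpha> \<gamma>(2) j mn
    by (subst ev_mult_eq_sum[of "Suc j"]) (auto simp: deglt_Suc_iff pact_def e_def intro!: sum.neutral)
  moreover have "ev c (L * \<alpha> * (L' * \<gamma>)) = 0"
  proof (subst ev_mult_eq_sum[of j])
    show "deglt j (L' * \<gamma>)"
      using deglt_mult[OF degL' \<gamma>(1)] k by simp
  qed (use prim in \<open>auto simp: pact_def L_def intro!: sum.neutral\<close>)
  moreover have "\<alpha> * Polynomial.monom 1 q =
      (Polynomial.monom 1 q - L * L' * \<gamma>) * \<alpha> + L * \<alpha> * (L' * \<gamma>)"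
    by (simp add: algebra_simps)
  ultimately show ?thesis
    by (simp only: ev_add)
qed

end

text \<open>To be used with \<open>m = i + 1\<close> and \<open>n = d - i + 1\<close>, so that
  \<open>m + n - 1 - 2 * j\<close> counts the forms \<open>l 0\<close>, ...,
  \<open>l (d - 2 * j)\<close>; \<open>nz\<close> expresses that \<open>\<alpha>\<close> is nonzero
  in the algebra. The proof splits on whether the rank exceeds \<open>j\<close>.\<close>

lemma hodge_riemann_sequence:
  assumes tnn: "tnn m n (toep m c)" and mn: "m \<le> n" and j: "j < m"
    and l: "\<And>s. poslin (l s)" and \<alpha>: "Polynomial.degree \<alpha> \<le> j"
    and nz: "q + j < m + n - 1" "ev c (\<alpha> * Polynomial.monom 1 q) \<noteq> 0"
    and prim: "\<And>q. q < j \<Longrightarrow> ev c ((\<Prod>s<m + n - 1 - 2 * j. l s) * \<alpha> * Polynomial.monom 1 q) = 0"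
  shows "0 < (-1) ^ j * ev c ((\<Prod>s\<in>{1..<m + n - 1 - 2 * j}. l s) * \<alpha> * \<alpha>)"
proof (cases "\<forall>k\<le>j. nonzero_minor m n (toep m c) (Suc k)")
  case False
  have ex: "\<exists>k. \<not> nonzero_minor m n (toep m c) (Suc k)" using False by blast
  \<comment> \<open>The least failing size makes \<open>k\<close> the rank; the empty minor is 1,
    which settles \<open>k = 0\<close>.\<close>
  define k where "k = (LEAST k. \<not> nonzero_minor m n (toep m c) (Suc k))"
  have k: "\<not> nonzero_minor m n (toep m c) (Suc k)"
    unfolding k_def by (rule LeastI_ex[OF ex])
  have "k \<le> j"
    using False Least_le[of "\<lambda>k. \<not> nonzero_minor m n (toep m c) (Suc k)"] unfolding k_def by (meson order.trans)
  have "nonzero_minor m n (toep m c) k"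
  proof (cases k)
    case 0
    then show ?thesis by (auto simp: nonzero_minor_def incr_def detf_def)
  next
    case (Suc k')
    then show ?thesis
      using not_less_Least[of k' "\<lambda>k. \<not> nonzero_minor m n (toep m c) (Suc k)"] unfolding k_def by auto
  qed
  then interpret toeplitz_rank m n k c
    using tnn k j mn by unfold_locales auto
  have "ev c (\<alpha> * Polynomial.monom 1 q) = 0"
    by (rule annihilator_cancel[OF l \<open>k \<le> j\<close> j mn \<alpha> prim nz(1)])
  with nz(2) show ?thesis by simp
next
  case True
  define \<Lambda> where "\<Lambda> = (\<Prod>s\<in>{1..<m + n - 1 - 2 * j}. l s)"
  have N: "m + n - 1 - 2 * j = Suc (m + n - 2 - 2 * j)" using j mn by simp
  have \<Lambda>: "\<Lambda> = (\<Prod>s<m + n - 2 - 2 * j. l (Suc s))"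
    using prod.atLeast_Suc_lessThan_Suc_shift[of l 0 "m + n - 2 - 2 * j"]
    unfolding \<Lambda>_def N by (simp only: One_nat_def lessThan_atLeast0 o_def)
  have l\<Lambda>: "(\<Prod>s<m + n - 1 - 2 * j. l s) = l 0 * \<Lambda>"
    unfolding N \<Lambda> by (rule prod.lessThan_Suc_shift)
  \<comment> \<open>The determinant of size \<open>j\<close> takes two forms more than that of size
    \<open>j + 1\<close>; both are \<open>l 0\<close>, so it is enumerated twice.\<close>
  have ll\<Lambda>: "(\<Prod>s<m + n - 2 * j. case s of 0 \<Rightarrow> l 0 | Suc s \<Rightarrow> l s) = l 0 * l 0 * \<Lambda>"
  proof -
    have eq: "m + n - 2 * j = Suc (m + n - 1 - 2 * j)" using j mn by simp
    show ?thesis unfolding eq prod.lessThan_Suc_shift nat.case l\<Lambda> by (rule mult.assoc[symmetric])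
  qed
  have "0 < detf (Suc j) (toep (Suc j) (pact \<Lambda> c))"
    unfolding \<Lambda> using True l j mn by (intro toeplitz_prod_det_pos[OF _ tnn]) auto
  moreover have "0 < detf j (toep j (pact (l 0 * l 0) (pact \<Lambda> c)))"
    unfolding pact_mult[symmetric] ll\<Lambda>[symmetric]
  proof (intro toeplitz_prod_det_pos[OF _ tnn])
    show "nonzero_minor m n (toep m c) j"
      using True by (cases j) (auto simp: nonzero_minor_def incr_def detf_def)
  qed (use l j mn in \<open>auto split: nat.split\<close>)
  moreover have "\<alpha> \<noteq> 0" using nz(2) by auto
  moreover have "ev (pact \<Lambda> c) (l 0 * \<alpha> * Polynomial.monom 1 q) = 0" if "q < j" for q
    using prim[OF that] unfolding ev_pact l\<Lambda> by (simp only: mult_ac)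
  ultimately have "0 < (-1) ^ j * ev (pact \<Lambda> c) (\<alpha> * \<alpha>)"
    using \<alpha> l by (intro primitive_sign[of j "pact \<Lambda> c" "l 0"]) auto
  then show ?thesis by (simp add: ev_pact \<Lambda>_def mult_ac)
qed

section \<open>Dehomogenisation and the quotient algebra\<close>

lemma bicoeff_eqI: "(\<And>a b. bicoeff P a b = bicoeff Q a b) \<Longrightarrow> P = Q"
  unfolding bicoeff_def by (intro poly_eqI) simp

lemma bicoeff_simps [simp]:
  "bicoeff 0 a b = 0"
  "bicoeff (P + Q) a b = bicoeff P a b + bicoeff Q a b"
  "bicoeff (Polynomial.smult [:r:] P) a b = r * bicoeff P a b"
  "bicoeff (dX P) a b = real (Suc a) * bicoeff P (Suc a) b"
  "bicoeff (dY P) a b = real (Suc b) * bicoeff P a (Suc b)"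
  by (simp_all add: bicoeff_def dX_def dY_def coeff_map_poly coeff_pderiv of_nat_poly del: of_nat_Suc)

lemma bicoeff_sum: "bicoeff (sum f S) a b = (\<Sum>x\<in>S. bicoeff (f x) a b)"
  by (simp add: bicoeff_def coeff_sum)

lemma dX_dY: "dX (dY P) = dY (dX P)"
  by (rule bicoeff_eqI) simp

lemma dX_linear: "dX (P + Q) = dX P + dX Q" "dX (Polynomial.smult [:r:] P) = Polynomial.smult [:r:] (dX P)"
  by (rule bicoeff_eqI; simp add: algebra_simps)+

lemma dY_linear: "dY (P + Q) = dY P + dY Q" "dY (Polynomial.smult [:r:] P) = Polynomial.smult [:r:] (dY P)"
  by (rule bicoeff_eqI; simp add: algebra_simps)+

text \<open>The summation bounds in \<open>act\<close> vary with \<open>\<alpha>\<close>; any box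
  containing its support gives the same sum.\<close>

lemma act_eq_sum:
  assumes "\<And>a b. bicoeff \<alpha> a b \<noteq> 0 \<Longrightarrow> a \<le> m \<and> b \<le> n"
  shows "\<alpha> \<bullet>\<^sub>d F = (\<Sum>b\<le>n. \<Sum>a\<le>m. Polynomial.smult [:bicoeff \<alpha> a b:] ((dX ^^ a) ((dY ^^ b) F)))"
proof -
  let ?t = "\<lambda>a b. Polynomial.smult [:bicoeff \<alpha> a b:] ((dX ^^ a) ((dY ^^ b) F))"
  have inner: "(\<Sum>a\<le>Polynomial.degree (Polynomial.coeff \<alpha> b). ?t a b) = (\<Sum>a\<le>m. ?t a b)" for b
  proof -
    define N where "N = max m (Polynomial.degree (Polynomial.coeff \<alpha> b))"
    have "(\<Sum>a\<le>Polynomial.degree (Polynomial.coeff \<alpha> b). ?t a b) = (\<Sum>a\<le>N. ?t a b)"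
      by (rule sum.mono_neutral_left) (auto simp: N_def bicoeff_def coeff_eq_0)
    also have "\<dots> = (\<Sum>a\<le>m. ?t a b)"
      using assms by (intro sum.mono_neutral_right) (force simp: N_def)+
    finally show ?thesis .
  qed
  define N where "N = max n (Polynomial.degree \<alpha>)"
  have "\<alpha> \<bullet>\<^sub>d F = (\<Sum>b\<le>Polynomial.degree \<alpha>. \<Sum>a\<le>m. ?t a b)"
    unfolding act_def inner ..
  also have "\<dots> = (\<Sum>b\<le>N. \<Sum>a\<le>m. ?t a b)"
    by (rule sum.mono_neutral_left) (auto simp: N_def bicoeff_def coeff_eq_0)
  also have "\<dots> = (\<Sum>b\<le>n. \<Sum>a\<le>m. ?t a b)"
    using assms by (intro sum.mono_neutral_right) (force simp: N_def intro!: sum.neutral)+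
  finally show ?thesis .
qed

lemma act_0 [simp]: "0 \<bullet>\<^sub>d F = 0"
  by (simp add: act_def)

text \<open>A Horner recursion in the outer variable. With \<open>act_const_pCons\<close> for the
  inner one, it lets the laws of the action be proved by induction instead of with the double
  sum.\<close>

lemma act_pCons: "pCons p \<alpha> \<bullet>\<^sub>d F = [:p:] \<bullet>\<^sub>d F + \<alpha> \<bullet>\<^sub>d dY F"
proof (cases "\<alpha> = 0")
  case False
  have "pCons p \<alpha> \<bullet>\<^sub>d F = (\<Sum>a\<le>Polynomial.degree p. Polynomial.smult [:bicoeff (pCons p \<alpha>) a 0:] ((dX ^^ a) F))
      + (\<Sum>b\<le>Polynomial.degree \<alpha>. \<Sum>a\<le>Polynomial.degree (Polynomial.coeff \<alpha> b).
          Polynomial.smult [:bicoeff (pCons p \<alpha>) a (Suc b):] ((dX ^^ a) ((dY ^^ Suc b) F)))"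
    using False unfolding act_def by (simp add: sum.atMost_Suc_shift del: funpow.simps sum.atMost_Suc)
  then show ?thesis
    unfolding act_def by (simp add: bicoeff_def funpow_Suc_right del: funpow.simps)
qed simp

lemma act_const_0 [simp]: "[:0:] \<bullet>\<^sub>d F = 0"
  by simp

lemma act_const_pCons: "[:pCons r p:] \<bullet>\<^sub>d F = Polynomial.smult [:r:] F + [:p:] \<bullet>\<^sub>d dX F"
proof (cases "p = 0")
  case False
  then show ?thesis
    unfolding act_def
    by (simp add: sum.atMost_Suc_shift bicoeff_def funpow_Suc_right del: funpow.simps sum.atMost_Suc)
qed (simp add: act_def bicoeff_def)

lemma act_const_commute:
  assumes T: "\<And>P Q. T (P + Q) = T P + T Q" "\<And>r P. T (Polynomial.smult [:r:] P) = Polynomial.smult [:r:] (T P)"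
    "\<And>P. T (dX P) = dX (T P)"
  shows "[:p:] \<bullet>\<^sub>d T F = T ([:p:] \<bullet>\<^sub>d F)"
proof (induction p arbitrary: F)
  case 0
  have "T 0 = 0" using T(2)[of 0 0] by simp
  then show ?case by simp
next
  case (pCons r p)
  then show ?case by (simp only: act_const_pCons T(1,2) T(3)[symmetric])
qed

text \<open>Every \<open>\<alpha>\<close> acts as a polynomial in \<open>dX\<close> and
  \<open>dY\<close>. This serves for \<open>T\<close> being \<open>dX\<close>, \<open>dY\<close> or
  multiplication by a scalar.\<close>

lemma act_commute:
  assumes T: "\<And>P Q. T (P + Q) = T P + T Q" "\<And>r P. T (Polynomial.smult [:r:] P) = Polynomial.smult [:r:] (T P)"
    "\<And>P. T (dX P) = dX (T P)" "\<And>P. T (dY P) = dY (T P)"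
  shows "\<alpha> \<bullet>\<^sub>d T F = T (\<alpha> \<bullet>\<^sub>d F)"
proof (induction \<alpha> arbitrary: F)
  case 0
  have "T 0 = 0" using T(2)[of 0 0] by simp
  then show ?case by simp
next
  case (pCons p \<alpha>)
  have "[:p:] \<bullet>\<^sub>d T F = T ([:p:] \<bullet>\<^sub>d F)"
    by (rule act_const_commute) (fact T)+
  with pCons.IH show ?case by (simp only: act_pCons[of p \<alpha>] T(1) T(4)[symmetric])
qed

lemma act_dX: "\<alpha> \<bullet>\<^sub>d dX F = dX (\<alpha> \<bullet>\<^sub>d F)"
  by (rule act_commute) (simp_all add: dX_linear dX_dY)

lemma act_dY: "\<alpha> \<bullet>\<^sub>d dY F = dY (\<alpha> \<bullet>\<^sub>d F)"
  by (rule act_commute) (simp_all add: dY_linear dX_dY)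

lemma act_smult_right: "\<alpha> \<bullet>\<^sub>d Polynomial.smult [:r:] F = Polynomial.smult [:r:] (\<alpha> \<bullet>\<^sub>d F)"
  by (rule act_commute) (simp_all add: dX_linear dY_linear smult_add_right mult.commute)

lemma act_const_add_left: "[:p + q:] \<bullet>\<^sub>d F = [:p:] \<bullet>\<^sub>d F + [:q:] \<bullet>\<^sub>d F"
proof (induction p q arbitrary: F rule: poly_induct2)
  case (pCons a p b q)
  have "[:pCons a p + pCons b q:] \<bullet>\<^sub>d F = [:pCons (a + b) (p + q):] \<bullet>\<^sub>d F" by simp
  also have "\<dots> = Polynomial.smult [:a + b:] F + [:p + q:] \<bullet>\<^sub>d dX F" by (rule act_const_pCons)
  also have "Polynomial.smult [:a + b:] F = Polynomial.smult [:a:] F + Polynomial.smult [:b:] F"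
    by (rule bicoeff_eqI) (simp add: algebra_simps)
  finally show ?case by (simp add: pCons.IH act_const_pCons)
qed simp

lemma act_add_left: "(\<alpha> + \<beta>) \<bullet>\<^sub>d F = \<alpha> \<bullet>\<^sub>d F + \<beta> \<bullet>\<^sub>d F"
proof (induction \<alpha> \<beta> arbitrary: F rule: poly_induct2)
  case (pCons p \<alpha> q \<beta>)
  have "(pCons p \<alpha> + pCons q \<beta>) \<bullet>\<^sub>d F = pCons (p + q) (\<alpha> + \<beta>) \<bullet>\<^sub>d F" by simp
  also have "\<dots> = [:p + q:] \<bullet>\<^sub>d F + (\<alpha> + \<beta>) \<bullet>\<^sub>d dY F" by (rule act_pCons)
  finally show ?case by (simp add: pCons.IH act_const_add_left act_pCons[of p \<alpha>] act_pCons[of q \<beta>])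
qed simp

lemma act_smult_left: "Polynomial.smult [:r:] \<alpha> \<bullet>\<^sub>d F = Polynomial.smult [:r:] (\<alpha> \<bullet>\<^sub>d F)"
proof (induction \<alpha> arbitrary: F)
  case (pCons p \<alpha>)
  have *: "[:Polynomial.smult r p:] \<bullet>\<^sub>d F = Polynomial.smult [:r:] ([:p:] \<bullet>\<^sub>d F)" for F
  proof (induction p arbitrary: F)
    case (pCons a p)
    have "Polynomial.smult [:r * a:] F = Polynomial.smult [:r:] (Polynomial.smult [:a:] F)"
      by (simp add: mult.commute)
    then show ?case by (simp only: smult_pCons act_const_pCons pCons.IH smult_add_right)
  qed simp
  have "Polynomial.smult [:r:] (pCons p \<alpha>) = pCons (Polynomial.smult r p) (Polynomial.smult [:r:] \<alpha>)"
    by simp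
  then show ?case
    by (simp only: act_pCons[of _ "Polynomial.smult [:r:] \<alpha>"] act_pCons[of p \<alpha>] * pCons.IH smult_add_right)
qed simp

lemma act_smult_x: "Polynomial.smult [:0, 1:] \<alpha> \<bullet>\<^sub>d F = \<alpha> \<bullet>\<^sub>d dX F"
proof (induction \<alpha> arbitrary: F)
  case (pCons p \<alpha>)
  have "[:[:0, 1:] * p:] \<bullet>\<^sub>d F = [:p:] \<bullet>\<^sub>d dX F"
    by (simp add: act_const_pCons)
  then show ?case
    by (simp only: smult_pCons act_pCons[of _ "Polynomial.smult [:0, 1:] \<alpha>"] act_pCons[of p \<alpha>] pCons.IH dX_dY)
qed simp

lemma act_smult_poly: "Polynomial.smult p \<alpha> \<bullet>\<^sub>d F = [:p:] \<bullet>\<^sub>d (\<alpha> \<bullet>\<^sub>d F)"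
proof (induction p)
  case (pCons r p)
  have "Polynomial.smult (pCons r p) \<alpha> = Polynomial.smult [:r:] \<alpha> + Polynomial.smult [:0, 1:] (Polynomial.smult p \<alpha>)"
    by (simp add: smult_add_left[symmetric])
  then have "Polynomial.smult (pCons r p) \<alpha> \<bullet>\<^sub>d F =
      Polynomial.smult [:r:] (\<alpha> \<bullet>\<^sub>d F) + dX (Polynomial.smult p \<alpha> \<bullet>\<^sub>d F)"
    by (simp only: act_add_left act_smult_left act_smult_x act_dX)
  then show ?case by (simp only: pCons.IH act_const_pCons act_dX)
qed simp

lemma act_mult: "(\<alpha> * \<beta>) \<bullet>\<^sub>d F = \<alpha> \<bullet>\<^sub>d (\<beta> \<bullet>\<^sub>d F)"
proof (induction \<alpha> arbitrary: F)
  case (pCons p \<alpha>)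
  have "pCons p \<alpha> * \<beta> = Polynomial.smult p \<beta> + pCons 0 (\<alpha> * \<beta>)" by simp
  then have "(pCons p \<alpha> * \<beta>) \<bullet>\<^sub>d F = [:p:] \<bullet>\<^sub>d (\<beta> \<bullet>\<^sub>d F) + (\<alpha> * \<beta>) \<bullet>\<^sub>d dY F"
    by (simp only: act_add_left act_smult_poly act_pCons[of 0 "\<alpha> * \<beta>"] act_const_0 add_0)
  then show ?case by (simp only: pCons.IH act_pCons[of p \<alpha>] act_dY)
qed simp

lemma act_0_right [simp]: "\<alpha> \<bullet>\<^sub>d 0 = 0"
  using act_smult_right[of \<alpha> 0 0] by simp

section \<open>Forms and their dehomogenisation\<close>

lemma formsD: "P \<in> forms d \<Longrightarrow> a + b \<noteq> d \<Longrightarrow> bicoeff P a b = 0"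
  by (auto simp: forms_def)

lemma lin_forms: "lin a b \<in> forms 1"
  by (auto simp: forms_def bicoeff_def lin_def coeff_pCons split: nat.splits)

lemma one_forms: "1 \<in> forms 0"
  by (auto simp: forms_def bicoeff_def coeff_1 split: if_splits)

lemma mult_forms:
  assumes "P \<in> forms m" "Q \<in> forms n"
  shows "P * Q \<in> forms (m + n)"
proof -
  have "bicoeff (P * Q) a b = 0" if ne: "a + b \<noteq> m + n" for a b
  proof -
    have "bicoeff P i j * bicoeff Q (a - i) (b - j) = 0" if "i \<le> a" "j \<le> b" for i j
    proof (cases "i + j = m")
      case True
      then have "a - i + (b - j) \<noteq> n" using that ne by linarith
      then show ?thesis using formsD[OF assms(2)] by simp
    qed (simp add: formsD[OF assms(1)])
    then show ?thesis
      unfolding bicoeff_def by (simp only: coeff_mult coeff_sum) (intro sum.neutral ballI, simp)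
  qed
  then show ?thesis by (auto simp: forms_def)
qed

lemma prod_forms:
  assumes "\<And>s. s \<in> S \<Longrightarrow> l s \<in> forms 1" "finite S"
  shows "prod l S \<in> forms (card S)"
  using assms(2,1)
proof (induction S rule: finite_induct)
  case (insert x S)
  then show ?case using mult_forms[of "l x" 1 "prod l S" "card S"] by simp
qed (simp add: one_forms)

text \<open>In a form each power of the inner variable meets only one power of the outer one, so no
  coefficients merge when the latter is set to 1.\<close>

lemma coeff_dehom:
  assumes "\<alpha> \<in> forms m"
  shows "Polynomial.coeff (poly \<alpha> 1) a = (if a \<le> m then bicoeff \<alpha> a (m - a) else 0)"
proof -
  have "Polynomial.coeff (poly \<alpha> 1) a = (\<Sum>b\<le>Polynomial.degree \<alpha>. bicoeff \<alpha> a b)"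
    by (simp add: poly_altdef coeff_sum bicoeff_def)
  also have "\<dots> = (\<Sum>b\<le>max m (Polynomial.degree \<alpha>). bicoeff \<alpha> a b)"
    by (rule sum.mono_neutral_left) (auto simp: bicoeff_def coeff_eq_0)
  also have "\<dots> = (\<Sum>b\<le>max m (Polynomial.degree \<alpha>). if b = m - a then if a \<le> m then bicoeff \<alpha> a (m - a) else 0 else 0)"
    using formsD[OF assms] by (intro sum.cong) auto
  also have "\<dots> = (if a \<le> m then bicoeff \<alpha> a (m - a) else 0)"
    by (simp add: sum.delta) auto
  finally show ?thesis .
qed

lemma degree_dehom:
  assumes "\<alpha> \<in> forms m"
  shows "Polynomial.degree (poly \<alpha> 1) \<le> m"
  by (rule degree_le) (simp add: coeff_dehom[OF assms])

lemma bicoeff_funpow: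
  "bicoeff ((dX ^^ k) P) a b = fact (a + k) / fact a * bicoeff P (a + k) b"
  "bicoeff ((dY ^^ k) P) a b = fact (b + k) / fact b * bicoeff P a (b + k)"
proof (induction k arbitrary: a b)
  case (Suc k)
  have fact: "fact (Suc n) = real (Suc n) * fact n" for n by (rule fact_Suc)
  {
    case 1
    show ?case using Suc.IH(1)[of "Suc a" b] by (simp add: fact del: of_nat_Suc)
  next
    case 2
    show ?case using Suc.IH(2)[of a "Suc b"] by (simp add: fact del: of_nat_Suc)
  }
qed simp_all

text \<open>The bridge from differentiation to sequences: the factorials produced by differentiating
  combine with the binomial coefficient in \<open>F\<close> to \<open>d! / (u! v!)\<close>, the same
  for all monomials of \<open>\<alpha>\<close>.\<close>

lemma bicoeff_act:
  assumes F: "F \<in> forms d" and \<alpha>: "\<alpha> \<in> forms m"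
  shows "bicoeff (\<alpha> \<bullet>\<^sub>d F) u v =
    (if u + v + m = d
     then fact d / (fact u * fact v) * ev (divided_coeff d F) (poly \<alpha> 1 * Polynomial.monom 1 u) else 0)"
proof -
  have "\<alpha> \<bullet>\<^sub>d F = (\<Sum>b\<le>m. \<Sum>a\<le>m. Polynomial.smult [:bicoeff \<alpha> a b:] ((dX ^^ a) ((dY ^^ b) F)))"
    by (rule act_eq_sum) (use \<alpha> in \<open>fastforce simp: forms_def\<close>)
  then have "bicoeff (\<alpha> \<bullet>\<^sub>d F) u v = (\<Sum>b\<le>m. \<Sum>a\<le>m. bicoeff \<alpha> a b *
      (fact (u + a) / fact u * (fact (v + b) / fact v * bicoeff F (u + a) (v + b))))"
    by (simp add: bicoeff_sum bicoeff_funpow)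
  also have "\<dots> = (\<Sum>a\<le>m. \<Sum>b\<le>m. if b = m - a then bicoeff \<alpha> a (m - a) *
      (fact (u + a) / fact u * (fact (v + (m - a)) / fact v * bicoeff F (u + a) (v + (m - a)))) else 0)"
    by (subst sum.swap) (intro sum.cong refl, use formsD[OF \<alpha>] in auto)
  also have "\<dots> = (\<Sum>a\<le>m. bicoeff \<alpha> a (m - a) *
      (fact (u + a) / fact u * (fact (v + (m - a)) / fact v * bicoeff F (u + a) (v + (m - a)))))"
    by (simp add: sum.delta)
  also have "\<dots> = (if u + v + m = d
     then fact d / (fact u * fact v) * ev (divided_coeff d F) (poly \<alpha> 1 * Polynomial.monom 1 u) else 0)"
  proof (cases "u + v + m = d")
    case False
    then show ?thesis using formsD[OF F] by simp
  next
    case True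
    have "ev (divided_coeff d F) (poly \<alpha> 1 * Polynomial.monom 1 u) =
        ev (divided_coeff d F) (Polynomial.monom 1 u * poly \<alpha> 1)" by (simp add: mult.commute)
    also have "\<dots> = (\<Sum>a<Suc m. Polynomial.coeff (poly \<alpha> 1) a * divided_coeff d F (u + a))"
      using degree_dehom[OF \<alpha>] by (subst ev_mult_eq_sum[of "Suc m"]) (simp_all add: deglt_Suc_iff pact_def mult_monom)
    also have "\<dots> = (\<Sum>a\<le>m. bicoeff \<alpha> a (m - a) * divided_coeff d F (u + a))"
      by (intro sum.cong) (auto simp: coeff_dehom[OF \<alpha>])
    finally have E: "ev (divided_coeff d F) (poly \<alpha> 1 * Polynomial.monom 1 u) =
      (\<Sum>a\<le>m. bicoeff \<alpha> a (m - a) * divided_coeff d F (u + a))" .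
    have key: "fact (u + a) / fact u * (fact (v + (m - a)) / fact v * bicoeff F (u + a) (v + (m - a))) =
        fact d / (fact u * fact v) * divided_coeff d F (u + a)" if "a \<le> m" for a
    proof -
      have eq: "v + (m - a) = d - (u + a)" and le: "u + a \<le> d" using True that by auto
      have "fact d = fact (u + a) * fact (d - (u + a)) * real (d choose (u + a))"
        using binomial_fact_lemma[OF le] by (metis of_nat_fact of_nat_mult)
      moreover have "real (d choose (u + a)) \<noteq> 0" using le by simp
      ultimately show ?thesis
        unfolding eq divided_coeff_def by simp
    qed
    have "(\<Sum>a\<le>m. bicoeff \<alpha> a (m - a) *
        (fact (u + a) / fact u * (fact (v + (m - a)) / fact v * bicoeff F (u + a) (v + (m - a))))) =
      (\<Sum>a\<le>m. fact d / (fact u * fact v) * (bicoeff \<alpha> a (m - a) * divided_coeff d F (u + a)))"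
      by (rule sum.cong[OF refl], subst key) simp_all
    then show ?thesis
      by (simp only: True E sum_distrib_left if_True refl)
  qed
  finally show ?thesis .
qed

lemma act_top:
  assumes F: "F \<in> forms d" and \<alpha>: "\<alpha> \<in> forms d"
  shows "\<alpha> \<bullet>\<^sub>d F = [:[:fact d * ev (divided_coeff d F) (poly \<alpha> 1):]:]"
proof (rule bicoeff_eqI)
  fix u v
  have "bicoeff [:[:r:]:] u v = (if u = 0 \<and> v = 0 then r else 0)" for r
    by (auto simp: bicoeff_def coeff_pCons split: nat.splits)
  then show "bicoeff (\<alpha> \<bullet>\<^sub>d F) u v = bicoeff [:[:fact d * ev (divided_coeff d F) (poly \<alpha> 1):]:] u v"
    unfolding bicoeff_act[OF assms] by (auto simp: monom_0 one_pCons[symmetric])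
qed

section \<open>The quotient algebra, its classes and its integral\<close>

lemma Ann_ideal: "ideal (Ann F) R_ring"
proof -
  interpret R: cring "R_ring :: bipoly ring" by (rule cring_from_type_algebra)
  have uminus: "\<alpha> \<in> Ann F \<Longrightarrow> - \<alpha> \<in> Ann F" for \<alpha>
    using act_add_left[of \<alpha> "- \<alpha>" F] by (simp add: Ann_def)
  have inv: "\<ominus>\<^bsub>R_ring\<^esub> \<alpha> = - \<alpha>" for \<alpha> :: bipoly
    by (rule R.minus_equality) (auto simp: ring_of_type_algebra_def)
  show ?thesis
  proof (rule idealI)
    show "subgroup (Ann F) (add_monoid R_ring)"
    proof (rule R.add.subgroupI)
      show "Ann F \<noteq> {}" by (auto simp: Ann_def intro!: exI[of _ 0])
    next
      fix \<alpha> assume "\<alpha> \<in> Ann F"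
      then show "\<ominus>\<^bsub>R_ring\<^esub> \<alpha> \<in> Ann F" using uminus inv by simp
    qed (auto simp: Ann_def ring_of_type_algebra_def act_add_left)
  next
    fix \<alpha> \<beta> assume a: "\<alpha> \<in> Ann F"
    then show "\<beta> \<otimes>\<^bsub>R_ring\<^esub> \<alpha> \<in> Ann F"
      by (simp add: Ann_def ring_of_type_algebra_def act_mult)
    have "(\<alpha> * \<beta>) \<bullet>\<^sub>d F = (\<beta> * \<alpha>) \<bullet>\<^sub>d F" by (simp add: mult.commute)
    then show "\<alpha> \<otimes>\<^bsub>R_ring\<^esub> \<beta> \<in> Ann F"
      using a by (simp add: Ann_def ring_of_type_algebra_def act_mult)
  qed (rule R.ring_axioms)
qed

lemma A_alg_cring: "cring (A_alg F)"
  unfolding A_alg_def by (rule ideal.quotient_is_cring[OF Ann_ideal]) (rule cring_from_type_algebra)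

lemma cls_hom: "ring_hom_cring R_ring (A_alg F) (cls F)"
proof -
  have "cls F = (+>\<^bsub>R_ring\<^esub>) (Ann F)" by (simp add: cls_def fun_eq_iff)
  then show ?thesis
    unfolding A_alg_def using ideal.rcos_ring_hom_cring[OF Ann_ideal cring_from_type_algebra] by simp
qed

lemma cls_closed: "cls F \<alpha> \<in> carrier (A_alg F)"
proof -
  interpret h: ring_hom_cring "R_ring :: bipoly ring" "A_alg F" "cls F" by (rule cls_hom)
  show ?thesis by (rule h.hom_closed) (simp add: ring_of_type_algebra_def)
qed

lemma cls_mult: "cls F \<alpha> \<otimes>\<^bsub>A_alg F\<^esub> cls F \<beta> = cls F (\<alpha> * \<beta>)"
proof -
  interpret h: ring_hom_cring "R_ring :: bipoly ring" "A_alg F" "cls F" by (rule cls_hom)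
  show ?thesis using h.hom_mult[of \<alpha> \<beta>] by (simp add: ring_of_type_algebra_def)
qed

lemma cls_one: "\<one>\<^bsub>A_alg F\<^esub> = cls F 1"
proof -
  interpret h: ring_hom_cring "R_ring :: bipoly ring" "A_alg F" "cls F" by (rule cls_hom)
  show ?thesis using h.hom_one by (simp add: ring_of_type_algebra_def)
qed

lemma cls_finprod:
  assumes "finite S"
  shows "(\<Otimes>\<^bsub>A_alg F\<^esub>k\<in>S. cls F (l k)) = cls F (\<Prod>k\<in>S. l k)"
proof -
  interpret A: cring "A_alg F" by (rule A_alg_cring)
  show ?thesis
    using assms
    by (induction S rule: finite_induct) (simp_all add: cls_one cls_closed cls_mult Pi_def)
qed

lemma cls_square: "cls F \<alpha> [^]\<^bsub>A_alg F\<^esub> (2::nat) = cls F (\<alpha> * \<alpha>)"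
proof -
  interpret A: cring "A_alg F" by (rule A_alg_cring)
  show ?thesis by (simp add: numeral_2_eq_2 cls_closed cls_mult)
qed

lemma mem_cls_iff: "\<beta> \<in> cls F \<alpha> \<longleftrightarrow> (\<beta> - \<alpha>) \<bullet>\<^sub>d F = 0"
proof -
  have "\<beta> \<in> cls F \<alpha> \<longleftrightarrow> (\<exists>h\<in>Ann F. \<beta> = h + \<alpha>)"
    by (simp add: cls_def a_r_coset_def r_coset_def ring_of_type_algebra_def)
  also have "\<dots> \<longleftrightarrow> \<beta> - \<alpha> \<in> Ann F" by (auto intro: bexI[of _ "\<beta> - \<alpha>"])
  finally show ?thesis by (simp add: Ann_def)
qed

lemma cls_eq_zero_iff: "cls F \<alpha> = \<zero>\<^bsub>A_alg F\<^esub> \<longleftrightarrow> \<alpha> \<bullet>\<^sub>d F = 0"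
proof -
  have zero: "\<zero>\<^bsub>A_alg F\<^esub> = Ann F" by (simp add: A_alg_def FactRing_def)
  have diff: "(\<beta> - \<alpha>) \<bullet>\<^sub>d F = \<beta> \<bullet>\<^sub>d F - \<alpha> \<bullet>\<^sub>d F" for \<beta>
    using act_add_left[of "\<beta> - \<alpha>" \<alpha> F] by (simp add: algebra_simps)
  have "\<alpha> \<in> cls F \<alpha>" by (simp add: mem_cls_iff)
  moreover have "\<beta> \<in> cls F \<alpha> \<longleftrightarrow> \<beta> \<in> Ann F" if "\<alpha> \<bullet>\<^sub>d F = 0" for \<beta>
    using that by (simp add: mem_cls_iff diff Ann_def)
  ultimately show ?thesis unfolding zero by (auto simp: Ann_def)
qed

text \<open>All representatives act on \<open>F\<close> in the same way, and \<open>\<alpha>\<close>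
  is one of them, so the described constant exists and is unique.\<close>

lemma integral_F_cls:
  assumes "\<alpha> \<bullet>\<^sub>d F = [:[:r:]:]"
  shows "integral_F F (cls F \<alpha>) = r"
  unfolding integral_F_def
proof (rule the_equality)
  have "\<beta> \<bullet>\<^sub>d F = \<alpha> \<bullet>\<^sub>d F" if "\<beta> \<in> cls F \<alpha>" for \<beta>
    using that act_add_left[of "\<beta> - \<alpha>" \<alpha> F] by (simp add: mem_cls_iff)
  then show "\<forall>\<beta>\<in>cls F \<alpha>. \<beta> \<bullet>\<^sub>d F = [:[:r:]:]" using assms by simp
next
  fix c assume "\<forall>\<beta>\<in>cls F \<alpha>. \<beta> \<bullet>\<^sub>d F = [:[:c:]:]"
  moreover have "\<alpha> \<in> cls F \<alpha>" by (simp add: mem_cls_iff)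
  ultimately show "c = r" using assms by auto
qed

section \<open>From submatrices on index sets to increasing selections\<close>

lemma pick_incr:
  assumes f: "incr k m f" and p: "p < k"
  shows "pick (f ` {..<k}) p = f p"
proof -
  have inj: "inj_on f {..<k}"
    using f by (intro linorder_inj_onI') (fastforce simp: incr_def)
  \<comment> \<open>\<open>pick\<close> recognises an element by the number of smaller ones; exactly
    \<open>p\<close> values of \<open>f\<close> lie below \<open>f p\<close>.\<close>
  have less_iff: "f q < f p \<longleftrightarrow> q < p" if "q < k" for q
    using f p that unfolding incr_def by (metis linorder_neqE_nat not_less_iff_gr_or_eq)
  have "{a \<in> f ` {..<k}. a < f p} = f ` {..<p}"
    using less_iff p by auto
  then have "card {a \<in> f ` {..<k}. a < f p} = p"
    using card_image[of f "{..<p}"] inj_on_subset[OF inj, of "{..<p}"] p by auto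
  then show ?thesis
    using pick_card_in_set[of "f p" "f ` {..<k}"] p by auto
qed

lemma totally_nonneg_imp_tnn:
  assumes "totally_nonneg M"
  shows "tnn (dim_row M) (dim_col M) (\<lambda>p q. M $$ (p, q))"
  unfolding tnn_def
proof (intro allI impI)
  fix k f g assume f: "incr k (dim_row M) f" and g: "incr k (dim_col M) g"
  have sub: "h ` {..<k} \<subseteq> {..<N}" if "incr k N h" for h N
    using that by (auto simp: incr_def)
  have card: "card (h ` {..<k}) = k" if "incr k N h" for h N
  proof -
    have "inj_on h {..<k}"
      using that by (intro linorder_inj_onI') (fastforce simp: incr_def)
    then show ?thesis by (simp add: card_image)
  qed
  have eq: "{i. i < N \<and> i \<in> h ` {..<k}} = h ` {..<k}" if "incr k N h" for h N
    using sub[OF that] by auto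
  have "submatrix M (f ` {..<k}) (g ` {..<k}) = mat k k (\<lambda>(p, q). M $$ (f p, g q))"
    unfolding submatrix_def eq[OF f] eq[OF g] card[OF f] card[OF g]
    by (intro eq_matI) (auto simp: pick_incr[OF f] pick_incr[OF g])
  then show "0 \<le> detf k (\<lambda>p q. M $$ (f p, g q))"
    using assms sub[OF f] sub[OF g] card[OF f] card[OF g]
    unfolding totally_nonneg_def detf_def by (metis (no_types, lifting))
qed

lemma poly_lin: "poly (lin a b) 1 = [:b, a:]"
  by (simp add: lin_def)

theorem theorem1p2:
  fixes d i :: nat and F :: "real poly poly"
  assumes "F \<in> forms d"
    and "i \<le> d div 2"
    and "totally_nonneg (toeplitz d i F)"
  shows "mixed_HRR d F i {lin a b | a b. a > 0 \<and> b > 0}"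
  unfolding mixed_HRR_def
proof (intro allI impI ballI)
  fix l :: "nat \<Rightarrow> bipoly" and j \<alpha>'
  assume l: "\<forall>k\<le>d. l k \<in> {lin a b | a b. a > 0 \<and> b > 0}" and j: "j \<le> i" and "\<alpha>' \<in> A_deg F j"
    and nz': "\<alpha>' \<noteq> \<zero>\<^bsub>A_alg F\<^esub>"
    and prim': "(\<Otimes>\<^bsub>A_alg F\<^esub>k\<in>{0..d - 2 * j}. cls F (l k)) \<otimes>\<^bsub>A_alg F\<^esub> \<alpha>' = \<zero>\<^bsub>A_alg F\<^esub>"
  then obtain \<alpha> where \<alpha>: "\<alpha> \<in> forms j" "\<alpha>' = cls F \<alpha>"
    by (auto simp: A_deg_def)
  have dj: "2 * j \<le> d" "2 * i \<le> d" using j assms(2) by auto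
  define c where "c = divided_coeff d F"
  \<comment> \<open>The lemmas on sequences ask for positivity at every index, so
    \<open>[:1, 1:]\<close> fills the places beyond \<open>d\<close>.\<close>
  define l' where "l' k = (if k \<le> d then poly (l k) 1 else [:1, 1:])" for k
  have l': "poslin (l' k)" for k
    using l[rule_format, of k] by (auto simp: l'_def poslin_def poly_lin)
  have forms: "l k \<in> forms 1" if "k \<le> d" for k
    using l[rule_format, OF that] lin_forms by auto
  have prod_l: "poly (\<Prod>k\<in>S. l k) 1 = (\<Prod>k\<in>S. l' k)" if "S \<subseteq> {..d}" for S
    unfolding poly_prod using that by (intro prod.cong) (auto simp: l'_def)
  have range: "i + 1 + (d - i + 1) - 1 - 2 * j = Suc (d - 2 * j)" using dj by auto

  have "tnn (i + 1) (d - i + 1) (\<lambda>p q. toeplitz d i F $$ (p, q))"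
    using totally_nonneg_imp_tnn[OF assms(3)] by (simp add: toeplitz_def)
  moreover have "tnn (i + 1) (d - i + 1) (\<lambda>p q. toeplitz d i F $$ (p, q)) \<longleftrightarrow> tnn (i + 1) (d - i + 1) (toep (i + 1) c)"
    by (rule tnn_cong) (simp add: toeplitz_def toep_def c_def)
  ultimately have tnn: "tnn (i + 1) (d - i + 1) (toep (i + 1) c)" by blast

  have "\<alpha> \<bullet>\<^sub>d F \<noteq> 0" using nz' by (simp add: \<alpha>(2) cls_eq_zero_iff)
  \<comment> \<open>By \<open>bicoeff_act\<close>, a nonzero coefficient yields a power
    \<open>t^u\<close> with \<open>u + j \<le> d\<close> that pairs nontrivially with
    \<open>\<alpha>\<close>.\<close>
  then obtain u v where "bicoeff (\<alpha> \<bullet>\<^sub>d F) u v \<noteq> 0"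
    using bicoeff_eqI[of "\<alpha> \<bullet>\<^sub>d F" 0] by auto
  then have u: "u + v + j = d" "ev c (poly \<alpha> 1 * Polynomial.monom 1 u) \<noteq> 0"
    by (auto simp: bicoeff_act[OF assms(1) \<alpha>(1)] c_def split: if_splits)

  define P where "P = (\<Prod>k\<in>{0..d - 2 * j}. l k)"
  have P: "P \<in> forms (Suc (d - 2 * j))"
  proof -
    have "prod l {0..d - 2 * j} \<in> forms (card {0..d - 2 * j})"
      by (rule prod_forms) (auto intro!: forms[unfolded One_nat_def])
    then show ?thesis by (simp add: P_def)
  qed
  have P1: "poly P 1 = (\<Prod>k<Suc (d - 2 * j). l' k)"
  proof -
    have eq: "{0..d - 2 * j} = {..<Suc (d - 2 * j)}" by auto
    have "{..<Suc (d - 2 * j)} \<subseteq> {..d}" by auto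
    then show ?thesis unfolding P_def eq by (rule prod_l)
  qed
  have P\<alpha>: "P * \<alpha> \<in> forms (Suc (d - 2 * j) + j)"
    by (rule mult_forms[OF P \<alpha>(1)])
  have "(P * \<alpha>) \<bullet>\<^sub>d F = 0"
    using prim' by (simp add: \<alpha>(2) cls_finprod cls_mult cls_eq_zero_iff P_def)
  \<comment> \<open>\<open>P * \<alpha>\<close> lowers degree \<open>d\<close> to
    \<open>j - 1\<close>, so the coefficient to look at has exponents \<open>q\<close> and
    \<open>j - 1 - q\<close>.\<close>
  then have prim: "ev c (poly P 1 * poly \<alpha> 1 * Polynomial.monom 1 q) = 0" if "q < j" for q
    using bicoeff_act[OF assms(1) P\<alpha>, of q "j - 1 - q"] that dj by (simp add: c_def)

  define Q where "Q = (\<Prod>k\<in>{1..d - 2 * j}. l k)"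
  have Q: "Q \<in> forms (d - 2 * j)"
  proof -
    have "prod l {1..d - 2 * j} \<in> forms (card {1..d - 2 * j})"
      by (rule prod_forms) (auto intro!: forms[unfolded One_nat_def])
    then show ?thesis by (simp add: Q_def)
  qed
  have Q1: "poly Q 1 = (\<Prod>k\<in>{1..<Suc (d - 2 * j)}. l' k)"
    unfolding Q_def atLeastLessThanSuc_atLeastAtMost by (rule prod_l) auto
  have "0 < (-1) ^ j * ev c (poly Q 1 * poly \<alpha> 1 * poly \<alpha> 1)"
    unfolding Q1 range[symmetric]
  proof (rule hodge_riemann_sequence[OF tnn])
    show "u + j < i + 1 + (d - i + 1) - 1" using u(1) dj by simp
    show "ev c ((\<Prod>k<i + 1 + (d - i + 1) - 1 - 2 * j. l' k) * poly \<alpha> 1 * Polynomial.monom 1 q) = 0"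
      if "q < j" for q
      unfolding range P1[symmetric] by (rule prim[OF that])
  qed (use dj j l' u(2) degree_dehom[OF \<alpha>(1)] in auto)
  also have "poly Q 1 * poly \<alpha> 1 * poly \<alpha> 1 = poly (Q * (\<alpha> * \<alpha>)) 1"
    by (simp add: mult_ac)
  finally have sign: "0 < (-1) ^ j * ev c (poly (Q * (\<alpha> * \<alpha>)) 1)" .
  have "Q * (\<alpha> * \<alpha>) \<in> forms (d - 2 * j + (j + j))"
    by (intro mult_forms Q \<alpha>(1))
  then have "(Q * (\<alpha> * \<alpha>)) \<bullet>\<^sub>d F = [:[:fact d * ev c (poly (Q * (\<alpha> * \<alpha>)) 1):]:]"
    unfolding c_def using dj by (intro act_top[OF assms(1)]) simp
  then have "integral_F F (cls F (Q * (\<alpha> * \<alpha>))) = fact d * ev c (poly (Q * (\<alpha> * \<alpha>)) 1)"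
    by (rule integral_F_cls)
  moreover have "(\<Otimes>\<^bsub>A_alg F\<^esub>k\<in>{1..d - 2 * j}. cls F (l k)) \<otimes>\<^bsub>A_alg F\<^esub> (\<alpha>' [^]\<^bsub>A_alg F\<^esub> (2::nat)) =
      cls F (Q * (\<alpha> * \<alpha>))"
    by (simp add: \<alpha>(2) cls_finprod cls_square cls_mult Q_def)
  \<comment> \<open>The integral differs from the value of \<open>ev\<close> by the positive factor
    \<open>d!\<close> of \<open>act_top\<close>.\<close>
  ultimately have eq: "(-1) ^ j * integral_F F ((\<Otimes>\<^bsub>A_alg F\<^esub>k\<in>{1..d - 2 * j}. cls F (l k)) \<otimes>\<^bsub>A_alg F\<^esub> (\<alpha>' [^]\<^bsub>A_alg F\<^esub> (2::nat))) =
      fact d * ((-1) ^ j * ev c (poly (Q * (\<alpha> * \<alpha>)) 1))"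
    by simp
  show "0 < (-1) ^ j * integral_F F ((\<Otimes>\<^bsub>A_alg F\<^esub>k\<in>{1..d - 2 * j}. cls F (l k)) \<otimes>\<^bsub>A_alg F\<^esub> (\<alpha>' [^]\<^bsub>A_alg F\<^esub> (2::nat)))"
    unfolding eq by (rule mult_pos_pos[OF _ sign]) simp
qed

end
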